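(* Let $p$ satisfy (H$_p$) and let $\varrho_0\in L^\infty(\mathbb{T}^d)$, $\varrho_0\ge0$. For every $T>0$ there exists a unique solution $(\eta,\sigma)\in L^\infty([0,T]\times\mathbb{T}^d)\times L^\infty([0,T]\times\mathbb{T}^d)$ of the Lagrangian system (L) with $\eta(0,y)=\varrho_0(y)$. Moreover, there is a constant $r$, independent of $T$, such that $\|\eta\|_{L^\infty([0,T]\times\mathbb{T}^d)}\le r$.
   Context: Assumption (H$_p$): $p:[0,\infty)\to\mathbb{R}$ is $C^1$, unbounded above, and there are constants $C>0$, $C_1,C_2\in\mathbb{R}$, $\bar\varrho>0$ with $-C\le p(\varrho)\le CP(\varrho)$ for all $\varrho\ge0$, where $P(\varrho):=\varrho\int_{\bar\varrho}^{\varrho}\frac{p(s)}{s^2}\,ds + C_1\varrho + C_2\ge 0$. The Lagrangian system (L) for unknowns $\eta,\sigma:[0,T]\times\mathbb{T}^d\to\mathbb{R}$ is \[ \partial_t\eta+\eta\sigma=0,\qquad \sigma=p(\eta)-\{p(\eta)\}_\sigma, \] understood as $\eta(t,y)=\varrho_0(y)-\int_0^t\eta(s,y)\sigma(s,y)\,ds$ and $\sigma(t,y)=p(\eta(t,y))-\{p(\eta)\}_\sigma(t)$ for a.e. $(t,y)$, where for a function $f(t,y)$ \[ \{f\}_\sigma(t)=\frac{1}{|\mathbb{T}^d|}\int_{\mathbb{T}^d}f(t,y)\exp\Big(\int_0^t\sigma(s,y)\,ds\Big)\,dy. \] *)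

theory Defs
  imports "HOL-Analysis.Analysis"
begin

text \<open>The flat torus is modelled by the unit cube [0,1]^d (the system (L) involves
  no derivatives in y, so only the measure space structure of the torus matters).\<close>
definition torus :: "(real^'d) set" where
  "torus = cbox 0 One"

definition Linfty_on :: "'a::euclidean_space set \<Rightarrow> ('a \<Rightarrow> real) \<Rightarrow> bool" where
  "Linfty_on S f \<longleftrightarrow> set_borel_measurable lebesgue S f \<and>
     (\<exists>B. AE x in lebesgue. x \<in> S \<longrightarrow> \<bar>f x\<bar> \<le> B)"

definition avg_sigma :: "(real \<Rightarrow> real^'d \<Rightarrow> real) \<Rightarrow> (real \<Rightarrow> real^'d \<Rightarrow> real) \<Rightarrow> real \<Rightarrow> real" where
  "avg_sigma \<sigma> f t = (1 / measure lebesgue (torus :: (real^'d) set)) *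
     (LINT y:torus|lebesgue. f t y * exp (LINT s:{0..t}|lebesgue. \<sigma> s y))"

definition Pfun :: "(real \<Rightarrow> real) \<Rightarrow> real \<Rightarrow> real \<Rightarrow> real \<Rightarrow> real \<Rightarrow> real" where
  "Pfun p rhobar C1 C2 x =
     x * interval_lebesgue_integral lborel (ereal rhobar) (ereal x) (\<lambda>s. p s / s^2) + C1 * x + C2"

text \<open>Assumption (H_p). C^1 on [0,\<infinity>) is one-sided at 0. The inequalities involving P are
  required for x > 0 (at x = 0 they follow by continuity, P(0) being defined as a limit).\<close>
definition Hp :: "(real \<Rightarrow> real) \<Rightarrow> bool" where
  "Hp p \<longleftrightarrow>
     (\<exists>D. (\<forall>x\<ge>0. (p has_real_derivative D x) (at x within {0..})) \<and> continuous_on {0..} D) \<and>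
     (\<forall>M. \<exists>x\<ge>0. p x > M) \<and>
     (\<exists>C>0. \<exists>C1 C2. \<exists>rhobar>0.
        (\<forall>x\<ge>0. - C \<le> p x) \<and>
        (\<forall>x>0. p x \<le> C * Pfun p rhobar C1 C2 x \<and> 0 \<le> Pfun p rhobar C1 C2 x))"

definition solves_L :: "(real \<Rightarrow> real) \<Rightarrow> (real^'d \<Rightarrow> real) \<Rightarrow> real \<Rightarrow>
    (real \<Rightarrow> real^'d \<Rightarrow> real) \<Rightarrow> (real \<Rightarrow> real^'d \<Rightarrow> real) \<Rightarrow> bool" where
  "solves_L p rho0 T \<eta> \<sigma> \<longleftrightarrow>
     Linfty_on ({0..T} \<times> torus) (\<lambda>(t,y). \<eta> t y) \<and>
     Linfty_on ({0..T} \<times> torus) (\<lambda>(t,y). \<sigma> t y) \<and>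
     (AE z in lebesgue. z \<in> {0..T} \<times> torus \<longrightarrow>
        (\<eta> (fst z) (snd z) = rho0 (snd z) - (LINT s:{0..fst z}|lebesgue. \<eta> s (snd z) * \<sigma> s (snd z)) \<and>
         \<sigma> (fst z) (snd z) = p (\<eta> (fst z) (snd z)) - avg_sigma \<sigma> (\<lambda>t y. p (\<eta> t y)) (fst z)))"

end

theory Submission
  imports Defs "HOL-Probability.Probability_Measure"
begin

text \<open>
  Put \<open>u(t,y)\<close> for the time integral of \<open>\<sigma>(s,y)\<close> over \<open>[0,t]\<close>. Then \<open>\<eta> = \<rho> exp(-u)\<close>, and (L)
  becomes \<open>u' = p(\<rho> exp(-u)) - m(t)\<close> with \<open>m(t)\<close> the mean of \<open>p(\<rho> exp(-u)) exp(u)\<close>. Two such flows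
  are compared in the mean square, for which the right-hand side is one-sided Lipschitz.

  For existence, \<open>u\<close> is sought as a function of \<open>t\<close> and of the initial density \<open>x = \<rho>(y)\<close>, so that
  the equation becomes an ordinary differential equation with a locally Lipschitz right-hand side
  in the Banach space of bounded continuous functions of \<open>x\<close>. It is solved globally with the help
  of an a priori bound: the mean of \<open>exp(u)\<close> stays equal to 1, the energy \<open>E(t)\<close>, i.e. the mean
  of \<open>P(\<eta>) exp(u)\<close>, dissipates at the rate given by the mean square of \<open>p - m\<close>, and so
  \<open>-C \<le> m \<le> C E(0)\<close>.
  If \<open>r\<close> is at least the maximum of \<open>\<rho>\<close> and \<open>p(r) > C E(0)\<close>, then \<open>\<eta>\<close> cannot cross \<open>r\<close> upwards,
  for any time horizon; this bounds \<open>u'\<close>.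
\<close>

section \<open>One-dimensional comparison arguments\<close>

lemma first_hitting_time:
  fixes f :: "real \<Rightarrow> real"
  assumes "continuous_on {a..b} f" "a \<le> b" "f a \<le> K" "K \<le> f b"
  obtains s where "s \<in> {a..b}" "f s = K" "\<And>x. a \<le> x \<Longrightarrow> x < s \<Longrightarrow> f x < K"
proof -
  let ?S = "{a..b} \<inter> f -` {K}"
  have "closed ?S" using assms(1) by (intro continuous_closed_preimage) auto
  moreover have "?S = {a..b} \<inter> ?S" by blast
  ultimately have "compact ?S" by (metis compact_Icc compact_Int_closed)
  moreover have "?S \<noteq> {}"
    using IVT'[of f a K b] assms by auto
  ultimately obtain s where s: "s \<in> ?S" "\<And>x. x \<in> ?S \<Longrightarrow> s \<le> x"
    using compact_attains_inf[of ?S] by metis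
  have "f x < K" if x: "a \<le> x" "x < s" for x
  proof (rule ccontr)
    assume "\<not> f x < K"
    moreover have "continuous_on {a..x} f"
      using x s(1) by (intro continuous_on_subset[OF assms(1)]) auto
    ultimately obtain y where "a \<le> y" "y \<le> x" "f y = K"
      using IVT'[of f a K x] assms(3) x(1) by auto
    then show False using s(1) s(2)[of y] x(2) by auto
  qed
  then show thesis using s(1) by (intro that[of s]) auto
qed

lemma last_hitting_time:
  fixes f :: "real \<Rightarrow> real"
  assumes "continuous_on {a..b} f" "a \<le> b" "f a \<le> K" "K \<le> f b"
  obtains s where "s \<in> {a..b}" "f s = K" "\<And>x. s < x \<Longrightarrow> x \<le> b \<Longrightarrow> K < f x"
proof -
  have "continuous_on {- b..- a} (\<lambda>x. - f (- x))"
    by (intro continuous_intros continuous_on_compose2[OF assms(1)]) auto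
  then obtain s where s: "s \<in> {- b..- a}" "- f (- s) = - K"
    "\<And>x. - b \<le> x \<Longrightarrow> x < s \<Longrightarrow> - f (- x) < - K"
    by (rule first_hitting_time[where K="- K"]) (use assms in auto)
  show thesis
  proof (rule that[of "- s"])
    show "K < f x" if "- s < x" "x \<le> b" for x using s(3)[of "- x"] that by auto
  qed (use s in auto)
qed

lemma le_if_decreasing_at_level:
  fixes f :: "real \<Rightarrow> real"
  assumes cont: "continuous_on {a..b} f" and "f a \<le> r"
    and deriv: "\<And>t. t \<in> {a..b} \<Longrightarrow> f t = r \<Longrightarrow> \<exists>l<0. (f has_real_derivative l) (at t within {a..b})"
    and t: "t \<in> {a..b}"
  shows "f t \<le> r"
proof (rule ccontr)
  assume "\<not> f t \<le> r"
  then obtain s where s: "s \<in> {a..t}" "f s = r" "\<And>x. s < x \<Longrightarrow> x \<le> t \<Longrightarrow> r < f x"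
    using last_hitting_time[of a t f r] continuous_on_subset[OF cont, of "{a..t}"] assms by auto
  then have "s < t" using \<open>\<not> f t \<le> r\<close> by (cases "s = t") auto
  obtain l where "l < 0" "(f has_real_derivative l) (at s within {a..b})"
    using deriv[of s] s t by auto
  then obtain d where d: "d > 0" "\<And>h. h > 0 \<Longrightarrow> s + h \<in> {a..b} \<Longrightarrow> h < d \<Longrightarrow> f (s + h) < f s"
    using has_real_derivative_neg_dec_right by metis
  define h where "h = min (d / 2) (t - s)"
  have "h > 0" "h < d" "s + h \<le> t" using d \<open>s < t\<close> by (auto simp: h_def)
  then show False using d(2)[of h] s(3)[of "s + h"] s(1,2) t by auto
qed

lemma continuity_bootstrap:
  fixes f :: "real \<Rightarrow> real"
  assumes cont: "continuous_on {a..b} f" and "f a \<le> K" "k < K"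
    and improve: "\<And>t. t \<in> {a..b} \<Longrightarrow> (\<And>s. s \<in> {a..t} \<Longrightarrow> f s \<le> K) \<Longrightarrow> f t \<le> k"
    and t: "t \<in> {a..b}"
  shows "f t \<le> k"
proof (rule improve[OF t], rule ccontr)
  fix s assume s: "s \<in> {a..t}" and "\<not> f s \<le> K"
  then obtain x where x: "x \<in> {a..s}" "f x = K" "\<And>y. a \<le> y \<Longrightarrow> y < x \<Longrightarrow> f y < K"
    using first_hitting_time[of a s f K] continuous_on_subset[OF cont, of "{a..s}"] assms by auto
  then have "f x \<le> k"
    using s t by (intro improve) (auto simp: le_less)
  then show False using x(2) \<open>k < K\<close> by simp
qed

lemma gronwall:
  fixes f f' :: "real \<Rightarrow> real"
  assumes deriv: "\<And>t. t \<in> {a..b} \<Longrightarrow> (f has_real_derivative f' t) (at t within {a..b})"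
    and deriv_le: "\<And>t. t \<in> {a..b} \<Longrightarrow> f' t \<le> K * f t"
    and t: "t \<in> {a..b}"
  shows "f t \<le> f a * exp (K * (t - a))"
proof -
  define g g' where "g s = f s * exp (- K * (s - a))"
    and "g' s = (f' s - K * f s) * exp (- K * (s - a))" for s
  have "(g has_derivative (*) (g' s)) (at s within {a..t})" if "a \<le> s" "s \<le> t" for s
  proof -
    have "(f has_real_derivative f' s) (at s within {a..t})"
      using t that by (intro DERIV_subset[OF deriv]) auto
    then have "(g has_real_derivative g' s) (at s within {a..t})"
      unfolding g_def g'_def by (auto intro!: derivative_eq_intros simp: algebra_simps)
    then show ?thesis by (rule has_field_derivative_imp_has_derivative)
  qed
  then obtain s where s: "s \<in> {a..t}" "g t - g a = g' s * (t - a)"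
    using mvt_very_simple[of a t g "\<lambda>s. (*) (g' s)"] t by auto
  have "g' s * (t - a) \<le> 0"
    using deriv_le[of s] s(1) t unfolding g'_def by (intro mult_nonpos_nonneg) auto
  then have "f t * exp (- K * (t - a)) \<le> f a"
    using s(2) by (simp add: g_def)
  then have "f t * exp (- K * (t - a)) * exp (K * (t - a)) \<le> f a * exp (K * (t - a))"
    by (intro mult_right_mono) auto
  then show ?thesis by (simp add: mult.assoc flip: exp_add)
qed

lemma constant_if_quadratic_increments:
  fixes f :: "real \<Rightarrow> real"
  assumes quadratic: "\<And>s t. a \<le> s \<Longrightarrow> s \<le> t \<Longrightarrow> t \<le> b \<Longrightarrow> \<bar>f t - f s\<bar> \<le> c * (t - s)\<^sup>2"
    and t: "t \<in> {a..b}"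
  shows "f t = f a"
proof -
  have increment: "\<bar>f y - f s\<bar> \<le> c * (y - s)\<^sup>2" if "s \<in> {a..b}" "y \<in> {a..b}" for s y
    using quadratic[of s y] quadratic[of y s] that
    by (cases "s \<le> y") (auto simp: abs_minus_commute power2_commute)
  have "(f has_real_derivative 0) (at s within {a..b})" if s: "s \<in> {a..b}" for s
    unfolding has_field_derivative_iff
  proof (rule Lim_null_comparison)
    have "\<bar>(f y - f s) / (y - s)\<bar> \<le> c * \<bar>y - s\<bar>" if "y \<in> {a..b}" "y \<noteq> s" for y
      using increment[OF s that(1)] that(2)
      by (auto simp: abs_divide divide_le_eq power2_eq_square mult.assoc)
    then show "eventually (\<lambda>y. norm ((f y - f s) / (y - s)) \<le> c * \<bar>y - s\<bar>) (at s within {a..b})"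
      by (auto simp: eventually_at_filter)
    show "((\<lambda>y. c * \<bar>y - s\<bar>) \<longlongrightarrow> 0) (at s within {a..b})"
      by (auto intro!: tendsto_eq_intros)
  qed
  then obtain k where "\<And>s. s \<in> {a..b} \<Longrightarrow> f s = k"
    using has_field_derivative_zero_constant[of "{a..b}" f] by auto
  then show ?thesis using t by (metis atLeastAtMost_iff order_refl order_trans)
qed

lemma exp_diff_le:
  fixes x y B :: real
  assumes "x \<le> B" "y \<le> B"
  shows "norm (exp x - exp y) \<le> exp B * norm (x - y)"
  using assms
  by (intro field_differentiable_bound[of "{..B}" exp exp]) (auto intro!: DERIV_subset[OF DERIV_exp])

section \<open>Ordinary differential equations in Banach spaces\<close>

lemma weighted_integral_diff_le:
  fixes h k :: "real \<Rightarrow> 'b::banach"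
  assumes "0 \<le> t" "0 \<le> d" "h integrable_on {0..t}" "k integrable_on {0..t}"
    and diff_le: "\<And>s. s \<in> {0..t} \<Longrightarrow> norm (h s - k s) \<le> d * (L * exp (2 * L * s))"
  shows "exp (- 2 * L * t) * norm (integral {0..t} h - integral {0..t} k) \<le> d / 2"
proof -
  have "((\<lambda>s. d * (L * exp (2 * L * s))) has_integral
    d * exp (2 * L * t) / 2 - d * exp (2 * L * 0) / 2) {0..t}"
    by (rule fundamental_theorem_of_calculus[OF assms(1)])
       (auto intro!: derivative_eq_intros simp flip: has_real_derivative_iff_has_vector_derivative)
  then have weight_integral:
    "((\<lambda>s. d * (L * exp (2 * L * s))) has_integral d * (exp (2 * L * t) - 1) / 2) {0..t}"
    by (simp add: algebra_simps diff_divide_distrib)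
  have "norm (integral {0..t} h - integral {0..t} k) = norm (integral {0..t} (\<lambda>s. h s - k s))"
    using assms by (simp add: Henstock_Kurzweil_Integration.integral_diff)
  also have "\<dots> \<le> integral {0..t} (\<lambda>s. d * (L * exp (2 * L * s)))"
    using assms weight_integral by (intro integral_norm_bound_integral) (auto intro: integrable_diff)
  also have "\<dots> = d * (exp (2 * L * t) - 1) / 2"
    using weight_integral by (rule integral_unique)
  also have "\<dots> \<le> d * exp (2 * L * t) / 2"
    using \<open>0 \<le> d\<close> by (simp add: mult_left_mono)
  finally show ?thesis by (simp add: exp_minus field_simps)
qed

instance bcontfun :: (metric_space, banach) banach ..

text \<open>The Picard operator contracts the supremum norm weighted by \<open>exp (- 2 * L * t)\<close>, on any time
  interval.\<close>

lemma weighted_picard_contraction: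
  fixes F :: "'b::banach \<Rightarrow> 'b" and v w :: "real \<Rightarrow>\<^sub>C 'b"
  assumes F: "L-lipschitz_on UNIV F" and t: "0 \<le> t"
  defines "h \<equiv> \<lambda>v s. F (exp (2 * L * s) *\<^sub>R apply_bcontfun v s)"
  shows "exp (- 2 * L * t) * norm (integral {0..t} (h v) - integral {0..t} (h w)) \<le> dist v w / 2"
proof (rule weighted_integral_diff_le[OF t])
  have L: "0 \<le> L" using F by (rule lipschitz_on_nonneg)
  show "h v integrable_on {0..t}" "h w integrable_on {0..t}"
    unfolding h_def
    by (intro integrable_continuous_real continuous_on_compose2[OF lipschitz_on_continuous_on[OF F]]
        continuous_intros; simp)+
  fix s
  have "norm (h v s - h w s) \<le> L * (exp (2 * L * s) * dist (apply_bcontfun v s) (apply_bcontfun w s))"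
    using lipschitz_on_normD[OF F] unfolding h_def
    by (metis UNIV_I abs_exp_cancel dist_norm norm_scaleR scaleR_diff_right)
  also have "\<dots> \<le> L * (exp (2 * L * s) * dist v w)"
    using L by (intro mult_left_mono dist_bounded) auto
  finally show "norm (h v s - h w s) \<le> dist v w * (L * exp (2 * L * s))" by (simp add: mult_ac)
qed simp

lemma picard_lindelof_integral_equation:
  fixes F :: "'b::banach \<Rightarrow> 'b" and T :: real
  assumes F: "L-lipschitz_on UNIV F" and T: "0 \<le> T"
  obtains u where "continuous_on UNIV u"
    "\<And>t. t \<in> {0..T} \<Longrightarrow> u t = u0 + integral {0..t} (\<lambda>s. F (u s))"
proof -
  define h where "h v s = F (exp (2 * L * s) *\<^sub>R apply_bcontfun v s)" for v :: "real \<Rightarrow>\<^sub>C 'b" and s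
  have h_integrable: "h v integrable_on {0..t}" for v t
    unfolding h_def
    by (intro integrable_continuous_real continuous_on_compose2[OF lipschitz_on_continuous_on[OF F]]
        continuous_intros) auto
  define \<Phi> where "\<Phi> v t = exp (- 2 * L * t) *\<^sub>R (u0 + integral {0..t} (h v))" for v t
  have "continuous_on (cbox 0 T) (\<Phi> v)" for v
    unfolding \<Phi>_def using h_integrable
    by (auto intro!: continuous_intros indefinite_integral_continuous_1)
  then have "\<exists>w. \<forall>t. apply_bcontfun w t = \<Phi> v (clamp 0 T t)" for v
    by (metis continuous_on_cbox_bcontfunE)
  then obtain H where H: "\<And>v t. apply_bcontfun (H v) t = \<Phi> v (clamp 0 T t)"
    by metis
  have clamp: "0 \<le> clamp 0 T t" for t using clamp_in_interval[of 0 T t] T by simp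
  have "dist (H v) (H w) \<le> (1 / 2) * dist v w" for v w
  proof (rule dist_bound)
    fix t
    have "exp (- 2 * L * clamp 0 T t)
        * norm (integral {0..clamp 0 T t} (h v) - integral {0..clamp 0 T t} (h w)) \<le> dist v w / 2"
      unfolding h_def[abs_def] by (rule weighted_picard_contraction[OF F clamp])
    then show "dist (apply_bcontfun (H v) t) (apply_bcontfun (H w) t) \<le> (1 / 2) * dist v w"
      unfolding H \<Phi>_def by (simp add: dist_norm flip: scaleR_diff_right)
  qed
  then obtain v where "H v = v"
    using banach_fix_type[of "1 / 2" H] by auto
  then have v_eq: "apply_bcontfun v t = \<Phi> v (clamp 0 T t)" for t by (metis H)
  define u where "u t = exp (2 * L * t) *\<^sub>R apply_bcontfun v t" for t
  show thesis
  proof (rule that)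
    show "continuous_on UNIV u" unfolding u_def by (intro continuous_intros) auto
    have "h v = (\<lambda>s. F (u s))" by (simp add: h_def u_def fun_eq_iff)
    then show "u t = u0 + integral {0..t} (\<lambda>s. F (u s))" if "t \<in> {0..T}" for t
      unfolding u_def[of t] v_eq[of t] using that by (simp add: \<Phi>_def exp_minus)
  qed
qed

theorem picard_lindelof_global:
  fixes F :: "'b::banach \<Rightarrow> 'b"
  assumes F: "L-lipschitz_on UNIV F" and T: "0 \<le> T"
  obtains u where "u 0 = u0"
    "\<And>t. t \<in> {0..T} \<Longrightarrow> (u has_vector_derivative F (u t)) (at t within {0..T})"
proof -
  obtain u where cont: "continuous_on UNIV u"
    and u_eq: "\<And>t. t \<in> {0..T} \<Longrightarrow> u t = u0 + integral {0..t} (\<lambda>s. F (u s))"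
    using picard_lindelof_integral_equation[OF assms] by blast
  have "continuous_on {0..T} (\<lambda>s. F (u s))"
    by (rule continuous_on_compose2[OF lipschitz_on_continuous_on[OF F] continuous_on_subset[OF cont]])
       auto
  then have "((\<lambda>t. u0 + integral {0..t} (\<lambda>s. F (u s))) has_vector_derivative F (u t))
    (at t within {0..T})" if "t \<in> {0..T}" for t
    using integral_has_vector_derivative[OF _ that] by (auto intro!: derivative_eq_intros)
  then have "(u has_vector_derivative F (u t)) (at t within {0..T})" if t: "t \<in> {0..T}" for t
    using has_vector_derivative_transform[OF t u_eq] t by fast
  moreover have "u 0 = u0" using u_eq[of 0] T by simp
  ultimately show thesis using that by blast
qed

definition radial_retraction :: "real \<Rightarrow> 'a::real_normed_vector \<Rightarrow> 'a" where
  "radial_retraction B x = (B / max B (norm x)) *\<^sub>R x"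

lemma radial_retraction_in_cball: "0 < B \<Longrightarrow> radial_retraction B x \<in> cball 0 B"
  by (auto simp: radial_retraction_def max_def divide_simps)

lemma radial_retraction_eq_self: "0 < B \<Longrightarrow> norm x \<le> B \<Longrightarrow> radial_retraction B x = x"
  by (simp add: radial_retraction_def max_def)

lemma radial_retraction_lipschitz:
  assumes B: "0 < B"
  shows "2-lipschitz_on S (radial_retraction B)"
proof (rule lipschitz_onI)
  fix x y :: 'a
  define a b where "a = max B (norm x)" and "b = max B (norm y)"
  have bounds: "0 < a" "0 < b" "B \<le> a" "norm y \<le> b" "\<bar>a - b\<bar> \<le> norm (x - y)"
    using B norm_triangle_ineq3[of x y] by (auto simp: a_def b_def)
  have "(B / a) *\<^sub>R x - (B / b) *\<^sub>R y = (B / a) *\<^sub>R (x - y) + ((B / a) * ((b - a) / b)) *\<^sub>R y"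
    using bounds by (simp add: algebra_simps diff_divide_distrib scaleR_left_diff_distrib)
  then have "norm ((B / a) *\<^sub>R x - (B / b) *\<^sub>R y)
      \<le> norm ((B / a) *\<^sub>R (x - y)) + norm (((B / a) * ((b - a) / b)) *\<^sub>R y)"
    by (metis norm_triangle_ineq)
  also have "\<dots> = (B / a) * norm (x - y) + (B / a) * (\<bar>a - b\<bar> * (norm y / b))"
    using bounds B by (simp add: abs_mult abs_divide abs_minus_commute)
  also have "\<dots> \<le> 1 * norm (x - y) + 1 * (norm (x - y) * 1)"
    using bounds B by (intro add_mono mult_mono) auto
  finally show "dist (radial_retraction B x) (radial_retraction B y) \<le> 2 * dist x y"
    by (simp add: radial_retraction_def dist_norm a_def b_def)
qed simp

theorem ode_solution_if_a_priori_bound: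
  fixes F :: "'b::banach \<Rightarrow> 'b"
  assumes lipschitz: "L-lipschitz_on (cball 0 B) F" and T: "0 \<le> T" and b: "norm u0 \<le> b" "b < B"
    and a_priori: "\<And>u t. t \<in> {0..T} \<Longrightarrow> u 0 = u0 \<Longrightarrow>
      (\<And>s. s \<in> {0..t} \<Longrightarrow> (u has_vector_derivative F (u s)) (at s within {0..t})) \<Longrightarrow> norm (u t) \<le> b"
  obtains u where "u 0 = u0"
    "\<And>t. t \<in> {0..T} \<Longrightarrow> (u has_vector_derivative F (u t)) (at t within {0..T})"
proof -
  let ?R = "radial_retraction B"
  have B: "0 < B" using order_trans[OF norm_ge_zero b(1)] b(2) by simp
  have "(L * 2)-lipschitz_on UNIV (\<lambda>x. F (?R x))"
    using radial_retraction_in_cball[OF B]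
    by (intro lipschitz_on_compose2 radial_retraction_lipschitz[OF B]
        lipschitz_on_subset[OF lipschitz]) auto
  then obtain u where u0: "u 0 = u0"
    and u: "\<And>t. t \<in> {0..T} \<Longrightarrow> (u has_vector_derivative F (?R (u t))) (at t within {0..T})"
    using picard_lindelof_global[OF _ T] by metis
  have "norm (u t) \<le> b" if "t \<in> {0..T}" for t
  proof (rule continuity_bootstrap[where f="\<lambda>t. norm (u t)", OF _ _ b(2) _ that])
    show "continuous_on {0..T} (\<lambda>t. norm (u t))"
      using u by (intro continuous_on_norm continuous_on_vector_derivative)
    fix t assume t: "t \<in> {0..T}" and norm_le: "\<And>s. s \<in> {0..t} \<Longrightarrow> norm (u s) \<le> B"
    show "norm (u t) \<le> b"
    proof (rule a_priori[of t u, OF t u0])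
      show "(u has_vector_derivative F (u s)) (at s within {0..t})" if s: "s \<in> {0..t}" for s
        using has_vector_derivative_within_subset[OF u[of s], of "{0..t}"] t s
          radial_retraction_eq_self[OF B norm_le[OF s]] by auto
    qed
  qed (use u0 b in auto)
  then have "?R (u t) = u t" if "t \<in> {0..T}" for t
    using that b by (intro radial_retraction_eq_self[OF B]) force
  then show thesis using that[of u] u0 u by simp
qed

section \<open>Integration\<close>

lemma has_real_derivative_lebesgue_integral:
  fixes g g' :: "real \<Rightarrow> 'a \<Rightarrow> real"
  assumes g_integrable: "\<And>t. t \<in> {a..b} \<Longrightarrow> integrable M (g t)"
    and g'_measurable: "\<And>t. t \<in> {a..b} \<Longrightarrow> g' t \<in> borel_measurable M"
    and w_integrable: "integrable M w"
    and deriv: "AE y in M. \<forall>t\<in>{a..b}. \<bar>g' t y\<bar> \<le> w y \<and>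
      ((\<lambda>t. g t y) has_real_derivative g' t y) (at t within {a..b})"
    and t: "t \<in> {a..b}"
  shows "((\<lambda>t. \<integral>y. g t y \<partial>M) has_real_derivative (\<integral>y. g' t y \<partial>M)) (at t within {a..b})"
  unfolding has_field_derivative_iff tendsto_at_iff_sequentially
proof (intro allI impI, simp only: comp_def)
  fix X assume X: "\<forall>i. X i \<in> {a..b} - {t}" "X \<longlonglongrightarrow> t"
  let ?q = "\<lambda>i y. (g (X i) y - g t y) / (X i - t)"
  have "(\<lambda>i. \<integral>y. ?q i y \<partial>M) \<longlonglongrightarrow> (\<integral>y. g' t y \<partial>M)"
  proof (rule integral_dominated_convergence[where w=w])
    show "AE y in M. (\<lambda>i. ?q i y) \<longlonglongrightarrow> g' t y"
      using deriv
    proof eventually_elim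
      case (elim y)
      then show ?case
        using X t unfolding has_field_derivative_iff tendsto_at_iff_sequentially
        by (auto simp: comp_def)
    qed
    show "AE y in M. norm (?q i y) \<le> w y" for i
      using deriv
    proof eventually_elim
      case (elim y)
      then have "norm (g (X i) y - g t y) \<le> w y * norm (X i - t)"
        using X t by (intro field_differentiable_bound[of "{a..b}"]) auto
      then show ?case using X(1)[rule_format, of i] by (auto simp: field_simps)
    qed
    show "?q i \<in> borel_measurable M" for i
      using g_integrable[of "X i"] g_integrable[OF t] X(1) by auto
  qed (use w_integrable t g'_measurable in auto)
  moreover have "(\<integral>y. ?q i y \<partial>M) = ((\<integral>y. g (X i) y \<partial>M) - (\<integral>y. g t y \<partial>M)) / (X i - t)" for i
    using X g_integrable t by (auto simp: Bochner_Integration.integral_diff)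
  ultimately show "(\<lambda>i. ((\<integral>y. g (X i) y \<partial>M) - (\<integral>y. g t y \<partial>M)) / (X i - t)) \<longlonglongrightarrow> (\<integral>y. g' t y \<partial>M)"
    by (simp only:)
qed

lemma (in prob_space) square_expectation_le:
  fixes X :: "'a \<Rightarrow> real"
  assumes "integrable M X" "integrable M (\<lambda>y. (X y)\<^sup>2)"
  shows "(expectation X)\<^sup>2 \<le> expectation (\<lambda>y. (X y)\<^sup>2)"
  using variance_eq[OF assms] variance_positive[of X] by simp

lemma borel_measurable_comp_continuous_on_nonneg:
  fixes f :: "'a \<Rightarrow> real" and q :: "real \<Rightarrow> real"
  assumes q: "continuous_on {0..} q" and f: "f \<in> borel_measurable M" "\<And>y. 0 \<le> f y"
  shows "(\<lambda>y. q (f y)) \<in> borel_measurable M"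
proof -
  have "q \<in> borel_measurable (restrict_space borel {0..})"
    using q by (rule borel_measurable_continuous_on_restrict)
  moreover have "f \<in> M \<rightarrow>\<^sub>M restrict_space borel {0..}"
    using f by (intro measurable_restrict_space2) auto
  ultimately show ?thesis by (rule measurable_compose[rotated])
qed

lemma (in pair_sigma_finite) AE_pair_swap:
  assumes "AE z in M1 \<Otimes>\<^sub>M M2. Q z"
  shows "AE y in M2. AE x in M1. Q (x, y)"
proof -
  interpret swap: pair_sigma_finite M2 M1 ..
  have "AE z in M2 \<Otimes>\<^sub>M M1. Q (case z of (y, x) \<Rightarrow> (x, y))"
    using assms by (subst (asm) distr_pair_swap) (rule AE_distrD[OF measurable_pair_swap'])
  from swap.AE_pair[OF this] show ?thesis by simp
qed

lemma AE_compose_if_null_preimages: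
  assumes f: "f \<in> M \<rightarrow>\<^sub>M N" and null: "\<And>A. A \<in> null_sets N \<Longrightarrow> AE z in M. f z \<notin> A"
    and "AE y in N. P y"
  shows "AE z in M. P (f z)"
proof -
  obtain A where A: "A \<in> null_sets N" "{y \<in> space N. \<not> P y} \<subseteq> A"
    using assms(3) by (auto simp: eventually_ae_filter)
  show ?thesis
    using null[OF A(1)] AE_space by eventually_elim (use A(2) measurable_space[OF f] in auto)
qed

lemma (in pair_sigma_finite) AE_pair_fst:
  assumes "AE x in M1. P x"
  shows "AE z in M1 \<Otimes>\<^sub>M M2. P (fst z)"
proof (rule AE_compose_if_null_preimages[OF measurable_fst _ assms])
  fix A assume A: "A \<in> null_sets M1"
  then have [measurable]: "A \<in> sets M1" by blast
  show "AE z in M1 \<Otimes>\<^sub>M M2. fst z \<notin> A"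
    by (rule AE_pair_measure) (use AE_not_in[OF A] in auto)
qed

lemma (in pair_sigma_finite) AE_pair_snd:
  assumes "AE y in M2. P y"
  shows "AE z in M1 \<Otimes>\<^sub>M M2. P (snd z)"
proof (rule AE_compose_if_null_preimages[OF measurable_snd _ assms])
  fix A assume A: "A \<in> null_sets M2"
  then have [measurable]: "A \<in> sets M2" by blast
  show "AE z in M1 \<Otimes>\<^sub>M M2. snd z \<notin> A"
    by (rule AE_pair_measure) (use AE_not_in[OF A] in auto)
qed

lemma has_integral_bounded_borel:
  fixes f :: "real \<Rightarrow> real"
  assumes f [measurable]: "f \<in> borel_measurable borel" and bound: "\<And>s. \<bar>f s\<bar> \<le> B"
  shows "(f has_integral (LINT s:{a..b}|lborel. f s)) {a..b}"
proof -
  have "set_integrable lborel {a..b} f"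
    unfolding set_integrable_def using bound
    by (intro integrableI_bounded_set_indicator[where B=B]) (auto simp: emeasure_lborel_Icc_eq)
  then show ?thesis
    by (simp add: set_borel_integral_eq_integral has_integral_iff)
qed

lemma set_lebesgue_integral_lebesgue_cong_AE:
  fixes f g :: "'a::euclidean_space \<Rightarrow> real"
  assumes [measurable]: "A \<in> sets borel" "g \<in> borel_measurable borel"
    and f_eq_g: "AE x in lborel. x \<in> A \<longrightarrow> f x = g x"
  shows "(LINT x:A|lebesgue. f x) = (LINT x:A|lborel. g x)"
proof -
  have indicator_eq: "AE x in lebesgue. indicat_real A x *\<^sub>R g x = indicat_real A x *\<^sub>R f x"
    using f_eq_g unfolding AE_completion_iff by eventually_elim (auto simp: indicator_def)
  have meas: "(\<lambda>x. indicat_real A x *\<^sub>R g x) \<in> borel_measurable lborel"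
    by measurable
  have "(LINT x:A|lebesgue. f x) = (LINT x:A|lebesgue. g x)"
    unfolding set_lebesgue_integral_def
    by (intro integral_cong_AE measurable_completion[OF meas]
          borel_measurable_AE[OF measurable_completion[OF meas] indicator_eq])
       (use indicator_eq in \<open>auto elim!: eventually_mono\<close>)
  also have "\<dots> = (LINT x:A|lborel. g x)"
    unfolding set_lebesgue_integral_def by (rule integral_completion[OF meas])
  finally show ?thesis .
qed

lemma borel_measurable_set_integral_atLeastAtMost:
  fixes g :: "real \<times> 'b \<Rightarrow> real"
  assumes [measurable]: "g \<in> borel_measurable (borel \<Otimes>\<^sub>M N)"
  shows "(\<lambda>(t, y). LINT s:{a..t}|lborel. g (s, y)) \<in> borel_measurable (borel \<Otimes>\<^sub>M N)"
  unfolding set_lebesgue_integral_def indicator_def atLeastAtMost_iff by measurable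

lemma set_integral_derivative:
  fixes f f' :: "real \<Rightarrow> real"
  assumes "a \<le> t"
    and deriv: "\<And>s. s \<in> {a..t} \<Longrightarrow> (f has_real_derivative f' s) (at s within {a..t})"
    and bound: "\<And>s. s \<in> {a..t} \<Longrightarrow> \<bar>f' s\<bar> \<le> B"
  shows "(LINT s:{a..t}|lebesgue. f' s) = f t - f a"
proof -
  have "(f' has_integral (f t - f a)) {a..t}"
    using assms
    by (intro fundamental_theorem_of_calculus) (auto simp: has_real_derivative_iff_has_vector_derivative)
  moreover from this have "f' absolutely_integrable_on {a..t}"
    using bound by (intro absolutely_integrable_integrable_bound[where g="\<lambda>_. B"]) auto
  ultimately show ?thesis by (simp add: set_lebesgue_integral_eq_integral integral_unique)
qed

lemma continuous_on_atLeast_bounded_on_Icc: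
  fixes q :: "real \<Rightarrow> real"
  assumes "continuous_on {0..} q"
  obtains K where "0 < K" "\<And>x. x \<in> {0..b} \<Longrightarrow> \<bar>q x\<bar> \<le> K"
proof -
  have "bounded (q ` {0..b})"
    by (intro compact_imp_bounded compact_continuous_image continuous_on_subset[OF assms]) auto
  then show thesis using that by (metis bounded_pos imageI real_norm_def)
qed

definition bounded_measurable :: "'a measure \<Rightarrow> real \<Rightarrow> ('a \<Rightarrow> real) set" where
  "bounded_measurable M B = {w \<in> borel_measurable M. \<forall>y. \<bar>w y\<bar> \<le> B}"

lemma bounded_measurableD [measurable_dest]: "w \<in> bounded_measurable M B \<Longrightarrow> w \<in> borel_measurable M"
  and bounded_measurable_abs_le: "w \<in> bounded_measurable M B \<Longrightarrow> \<bar>w y\<bar> \<le> B"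
  and bounded_measurable_range: "w \<in> bounded_measurable M B \<Longrightarrow> w y \<in> {- B..B}"
  by (auto simp: bounded_measurable_def abs_le_iff minus_le_iff)

lemma bounded_measurable_mono: "w \<in> bounded_measurable M B \<Longrightarrow> B \<le> C \<Longrightarrow> w \<in> bounded_measurable M C"
  unfolding bounded_measurable_def using order_trans by blast

lemma bounded_measurable_diff:
  assumes "w \<in> bounded_measurable M B" "w' \<in> bounded_measurable M B'"
  shows "(\<lambda>y. w y - w' y) \<in> bounded_measurable M (B + B')"
proof -
  have "\<bar>w y - w' y\<bar> \<le> B + B'" for y
    using bounded_measurable_abs_le[OF assms(1), of y] bounded_measurable_abs_le[OF assms(2), of y]
    by linarith
  then show ?thesis using assms by (auto simp: bounded_measurable_def)
qed

lemma bounded_measurable_mult: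
  assumes "w \<in> bounded_measurable M B" "w' \<in> bounded_measurable M B'"
  shows "(\<lambda>y. w y * w' y) \<in> bounded_measurable M (B * B')"
  using mult_mono'[OF bounded_measurable_abs_le[OF assms(1)] bounded_measurable_abs_le[OF assms(2)]]
    assms
  by (auto simp: bounded_measurable_def abs_mult)

lemma bounded_measurable_exp:
  "w \<in> bounded_measurable M B \<Longrightarrow> (\<lambda>y. exp (w y)) \<in> bounded_measurable M (exp B)"
  unfolding bounded_measurable_def by (auto dest: abs_le_D1)

lemma (in prob_space) integrable_bounded_measurable: "w \<in> bounded_measurable M B \<Longrightarrow> integrable M w"
  unfolding bounded_measurable_def by (intro integrable_const_bound[of _ B]) auto

lemma (in prob_space) abs_expectation_le:
  assumes "w \<in> bounded_measurable M B"
  shows "\<bar>expectation w\<bar> \<le> B"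
proof -
  have "\<bar>expectation w\<bar> \<le> expectation (\<lambda>y. \<bar>w y\<bar>)" by (rule integral_abs_bound)
  also have "\<dots> \<le> B"
    using integrable_bounded_measurable[OF assms] bounded_measurable_abs_le[OF assms]
    by (intro integral_le_const) auto
  finally show ?thesis .
qed

section \<open>Linear integral equations with a bounded coefficient\<close>

lemma exp_second_order_remainder:
  fixes x y B :: real
  assumes "x \<le> B" "y \<le> B"
  shows "\<bar>exp y - exp x - exp x * (y - x)\<bar> \<le> exp B * (y - x)\<^sup>2"
proof -
  have "norm ((exp y - exp x * y) - (exp x - exp x * x)) \<le> (exp B * norm (y - x)) * norm (y - x)"
  proof (rule field_differentiable_bound[of "closed_segment x y"])
    fix z assume "z \<in> closed_segment x y"
    then have z: "z \<in> {min x y..max x y}" by (auto simp: closed_segment_eq_real_ivl split: if_splits)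
    show "((\<lambda>z. exp z - exp x * z) has_real_derivative (exp z - exp x))
      (at z within closed_segment x y)"
      by (auto intro!: derivative_eq_intros)
    have "norm (exp z - exp x) \<le> exp B * norm (z - x)"
      using z assms by (intro exp_diff_le) auto
    also have "\<dots> \<le> exp B * norm (y - x)" using z by (intro mult_left_mono) auto
    finally show "norm (exp z - exp x) \<le> exp B * norm (y - x)" .
  qed auto
  then show ?thesis by (simp add: algebra_simps power2_eq_square)
qed

lemma indefinite_integral_increment:
  fixes f :: "real \<Rightarrow> 'b::banach"
  assumes "f integrable_on {a..b}" "a \<le> s" "s \<le> t" "t \<le> b"
  shows "integral {a..t} f - integral {a..s} f = integral {s..t} f"
  using Henstock_Kurzweil_Integration.integral_combine[of a s t f] assms
    integrable_on_subinterval[OF assms(1), of a t] by (auto simp: algebra_simps)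

lemma norm_integral_le:
  fixes f :: "real \<Rightarrow> 'b::banach"
  assumes "f integrable_on {s..t}" "s \<le> t" "\<And>r. r \<in> {s..t} \<Longrightarrow> norm (f r) \<le> B"
  shows "norm (integral {s..t} f) \<le> B * (t - s)"
proof (rule order_trans[OF integral_norm_bound_integral[where g="\<lambda>_. B"]])
  show "integral {s..t} (\<lambda>_. B) \<le> B * (t - s)" using assms(2) by (simp add: mult.commute)
qed (use assms in auto)

text \<open>The coefficient \<open>\<sigma>\<close> is merely integrable, so neither \<open>N\<close> nor the primitive \<open>U\<close> of \<open>\<sigma>\<close> need be
  differentiable everywhere; but the increments of \<open>N exp U\<close> are of second order.\<close>

context
  fixes N \<sigma> :: "real \<Rightarrow> real" and a B T :: real
  assumes \<sigma>_integrable: "\<sigma> integrable_on {0..T}" and \<sigma>_bound: "\<And>s. s \<in> {0..T} \<Longrightarrow> \<bar>\<sigma> s\<bar> \<le> B"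
    and N\<sigma>_integrable: "(\<lambda>s. N s * \<sigma> s) integrable_on {0..T}"
    and N_eq: "\<And>t. t \<in> {0..T} \<Longrightarrow> N t = a - integral {0..t} (\<lambda>s. N s * \<sigma> s)"
begin

private abbreviation (input) "U t \<equiv> integral {0..t} \<sigma>"

private lemma bound_nonneg: "0 \<le> s \<Longrightarrow> s \<le> T \<Longrightarrow> 0 \<le> B"
  using \<sigma>_bound[of s] by auto

private lemma U_increment:
  assumes "0 \<le> s" "s \<le> t" "t \<le> T"
  shows "\<bar>U t - U s\<bar> \<le> B * (t - s)"
  using assms norm_integral_le[of \<sigma> s t B] \<sigma>_bound integrable_on_subinterval[OF \<sigma>_integrable, of s t]
  by (simp add: indefinite_integral_increment[OF \<sigma>_integrable])

context
  fixes K :: real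
  assumes K: "0 \<le> K" "\<And>t. t \<in> {0..T} \<Longrightarrow> \<bar>N t\<bar> \<le> K"
begin

private lemma N_increment:
  assumes st: "0 \<le> s" "s \<le> t" "t \<le> T"
  shows "\<bar>N t - N s\<bar> \<le> K * B * (t - s)"
proof -
  have "N t - N s = - integral {s..t} (\<lambda>r. N r * \<sigma> r)"
    using indefinite_integral_increment[OF N\<sigma>_integrable st] N_eq[of s] N_eq[of t] st by simp
  moreover have "norm (integral {s..t} (\<lambda>r. N r * \<sigma> r)) \<le> K * B * (t - s)"
    using st K \<sigma>_bound integrable_on_subinterval[OF N\<sigma>_integrable, of s t]
    by (intro norm_integral_le) (auto simp: abs_mult intro!: mult_mono)
  ultimately show ?thesis by simp
qed

private lemma N_second_order_increment:
  assumes st: "0 \<le> s" "s \<le> t" "t \<le> T"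
  shows "\<bar>N t - N s + N s * (U t - U s)\<bar> \<le> K * B\<^sup>2 * (t - s)\<^sup>2"
proof -
  have integrable: "(\<lambda>r. N r * \<sigma> r) integrable_on {s..t}" "(\<lambda>r. N s * \<sigma> r) integrable_on {s..t}"
    using integrable_on_subinterval[OF N\<sigma>_integrable, of s t]
      integrable_on_subinterval[OF \<sigma>_integrable, of s t] st
    by (auto intro: integrable_on_mult_right)
  have "integral {s..t} (\<lambda>r. N r * \<sigma> r - N s * \<sigma> r)
      = integral {s..t} (\<lambda>r. N r * \<sigma> r) - N s * integral {s..t} \<sigma>"
    using integrable by (simp add: Henstock_Kurzweil_Integration.integral_diff)
  also have "\<dots> = - (N t - N s + N s * (U t - U s))"
    using indefinite_integral_increment[OF N\<sigma>_integrable st]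
      indefinite_integral_increment[OF \<sigma>_integrable st]
      N_eq[of s] N_eq[of t] st by simp
  finally have "\<bar>N t - N s + N s * (U t - U s)\<bar> = norm (integral {s..t} (\<lambda>r. N r * \<sigma> r - N s * \<sigma> r))"
    by simp
  also have "\<dots> \<le> (K * B * (t - s) * B) * (t - s)"
  proof (intro norm_integral_le integrable_diff integrable st)
    fix r assume r: "r \<in> {s..t}"
    have "\<bar>N r - N s\<bar> \<le> K * B * (r - s)" using r st by (intro N_increment) auto
    also have "\<dots> \<le> K * B * (t - s)"
      using r st K(1) bound_nonneg[of s] by (intro mult_left_mono) auto
    finally have "\<bar>N r - N s\<bar> * \<bar>\<sigma> r\<bar> \<le> K * B * (t - s) * B"
      using \<sigma>_bound[of r] r st K(1) bound_nonneg[of s] by (intro mult_mono) auto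
    then show "norm (N r * \<sigma> r - N s * \<sigma> r) \<le> K * B * (t - s) * B"
      by (simp add: abs_mult flip: left_diff_distrib)
  qed
  finally show ?thesis by (simp add: power2_eq_square algebra_simps)
qed

lemma linear_integral_equation_exp_increment:
  assumes st: "0 \<le> s" "s \<le> t" "t \<le> T"
  shows "\<bar>N t * exp (U t) - N s * exp (U s)\<bar> \<le> 3 * (K * B\<^sup>2 * exp (B * T)) * (t - s)\<^sup>2"
proof -
  define e where "e = exp (B * T)"
  define V where "V = U t - U s"
  have B: "0 \<le> B" using st by (intro bound_nonneg[of s]) auto
  have U_le: "U r \<le> B * T" if "0 \<le> r" "r \<le> T" for r
    using U_increment[of 0 r] that B mult_left_mono[of r T B] by auto
  have V: "\<bar>V\<bar> \<le> B * (t - s)" unfolding V_def using st by (rule U_increment)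
  have "\<bar>exp (U t) - exp (U s) - exp (U s) * V\<bar> \<le> e * V\<^sup>2"
    unfolding e_def V_def using st by (intro exp_second_order_remainder U_le) auto
  also have "\<dots> \<le> e * (B * (t - s))\<^sup>2"
    using V by (intro mult_left_mono) (auto simp: e_def abs_le_square_iff[symmetric])
  finally have exp_term: "\<bar>N t * (exp (U t) - exp (U s) - exp (U s) * V)\<bar> \<le> K * (e * (B * (t - s))\<^sup>2)"
    unfolding abs_mult using K st by (intro mult_mono) auto
  have cross_term: "\<bar>exp (U s) * (V * (N t - N s))\<bar> \<le> e * ((B * (t - s)) * (K * B * (t - s)))"
    unfolding abs_mult
    using N_increment[OF st] U_le[of s] V B st by (intro mult_mono) (auto simp: e_def)
  have N_term: "\<bar>exp (U s) * (N t - N s + N s * V)\<bar> \<le> e * (K * B\<^sup>2 * (t - s)\<^sup>2)"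
    unfolding abs_mult
    using N_second_order_increment[OF st] U_le[of s] st by (intro mult_mono) (auto simp: e_def V_def)
  have "N t * exp (U t) - N s * exp (U s) = N t * (exp (U t) - exp (U s) - exp (U s) * V)
      + exp (U s) * (V * (N t - N s)) + exp (U s) * (N t - N s + N s * V)"
    by (simp add: algebra_simps)
  then have "\<bar>N t * exp (U t) - N s * exp (U s)\<bar> \<le> K * (e * (B * (t - s))\<^sup>2)
      + e * ((B * (t - s)) * (K * B * (t - s))) + e * (K * B\<^sup>2 * (t - s)\<^sup>2)"
    using exp_term cross_term N_term by linarith
  also have "\<dots> = 3 * (K * B\<^sup>2 * e) * (t - s)\<^sup>2" by algebra
  finally show ?thesis by (simp add: e_def)
qed

end

lemma linear_integral_equation_exp:
  assumes t: "t \<in> {0..T}"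
  shows "N t = a * exp (- integral {0..t} \<sigma>)"
proof -
  have "continuous_on {0..T} (\<lambda>t. a - integral {0..t} (\<lambda>s. N s * \<sigma> s))"
    by (intro continuous_intros indefinite_integral_continuous_1 N\<sigma>_integrable)
  then have "continuous_on {0..T} N"
    by (rule continuous_on_eq) (use N_eq in auto)
  then have "bounded (N ` {0..T})"
    by (intro compact_imp_bounded compact_continuous_image) auto
  then obtain K where K: "0 < K" "\<And>t. t \<in> {0..T} \<Longrightarrow> \<bar>N t\<bar> \<le> K"
    using bounded_pos by (metis imageI real_norm_def)
  have "N t * exp (U t) = N 0 * exp (U 0)"
    using K
    by (intro constant_if_quadratic_increments[OF linear_integral_equation_exp_increment[of K] t]) auto
  also have "\<dots> = a" using N_eq[of 0] t by simp
  finally show ?thesis by (simp add: exp_minus field_simps)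
qed

end

lemma AE_linear_integral_equation_exp:
  fixes \<eta> \<sigma> h g :: "real \<Rightarrow> real"
  assumes h [measurable]: "h \<in> borel_measurable borel" and h_bound: "\<And>s. \<bar>h s\<bar> \<le> A"
    and g [measurable]: "g \<in> borel_measurable borel" and g_bound: "\<And>s. \<bar>g s\<bar> \<le> B"
    and \<eta>_h: "AE s in lborel. s \<in> {0..T} \<longrightarrow> \<eta> s = h s"
    and \<sigma>_g: "AE s in lborel. s \<in> {0..T} \<longrightarrow> \<sigma> s = g s"
    and \<eta>_eq: "AE t in lborel. t \<in> {0..T} \<longrightarrow> \<eta> t = a - (LINT s:{0..t}|lebesgue. \<eta> s * \<sigma> s)"
  shows "AE t in lborel. t \<in> {0..T} \<longrightarrow> \<eta> t = a * exp (- integral {0..t} g)"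
proof -
  have hg [measurable]: "(\<lambda>s. h s * g s) \<in> borel_measurable borel" by measurable
  have hg_bound: "\<bar>h s * g s\<bar> \<le> A * B" for s
    using h_bound[of s] g_bound[of s] unfolding abs_mult by (intro mult_mono) auto
  define N where "N t = a - integral {0..t} (\<lambda>s. h s * g s)" for t
  have integral_hg: "(LINT s:{0..t}|lebesgue. \<eta> s * \<sigma> s) = integral {0..t} (\<lambda>s. h s * g s)"
    if "t \<in> {0..T}" for t
  proof -
    have "AE s in lborel. s \<in> {0..t} \<longrightarrow> \<eta> s * \<sigma> s = h s * g s"
      using \<eta>_h \<sigma>_g by eventually_elim (use that in auto)
    then have "(LINT s:{0..t}|lebesgue. \<eta> s * \<sigma> s) = (LINT s:{0..t}|lborel. h s * g s)"
      by (intro set_lebesgue_integral_lebesgue_cong_AE) auto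
    also have "\<dots> = integral {0..t} (\<lambda>s. h s * g s)"
      using has_integral_bounded_borel[OF hg hg_bound] by (rule integral_unique[symmetric])
    finally show ?thesis .
  qed
  have \<eta>_N: "AE t in lborel. t \<in> {0..T} \<longrightarrow> \<eta> t = N t"
    using \<eta>_eq by eventually_elim (simp add: N_def integral_hg)
  have integral_N_iff_integral_h:
    "((\<lambda>s. N s * g s) has_integral k) {0..t} \<longleftrightarrow> ((\<lambda>s. h s * g s) has_integral k) {0..t}"
    if "t \<le> T" for t k
    by (rule has_integral_AE) (use \<eta>_N \<eta>_h in eventually_elim, use that in auto)
  have "N t = a * exp (- integral {0..t} g)" if "t \<in> {0..T}" for t
  proof (rule linear_integral_equation_exp[OF _ g_bound _ _ that])
    show "g integrable_on {0..T}"
      using has_integral_bounded_borel[OF g g_bound] by (rule has_integral_integrable)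
    show "(\<lambda>s. N s * g s) integrable_on {0..T}"
      using integral_N_iff_integral_h[of T] has_integral_bounded_borel[OF hg hg_bound]
      by (auto simp: integrable_on_def)
    fix t assume "t \<in> {0..T}"
    then have "((\<lambda>s. N s * g s) has_integral integral {0..t} (\<lambda>s. h s * g s)) {0..t}"
      using integral_N_iff_integral_h[of t] has_integral_bounded_borel[OF hg hg_bound, of 0 t]
      by (simp add: has_integral_iff)
    then show "N t = a - integral {0..t} (\<lambda>s. N s * g s)"
      by (simp add: N_def integral_unique)
  qed
  then show ?thesis using \<eta>_N by (auto elim!: eventually_mono)
qed

section \<open>Flows in Lagrangian coordinates\<close>

locale pressure_law =
  fixes p :: "real \<Rightarrow> real"
  assumes p_lipschitz: "\<And>b. \<exists>L. L-lipschitz_on {0..b} p"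
begin

lemma p_cont: "continuous_on {0..} p"
  unfolding continuous_on_eq_continuous_within
proof
  fix x :: real assume x: "x \<in> {0..}"
  obtain L where "L-lipschitz_on {0..x + 1} p" using p_lipschitz by blast
  then have "continuous (at x within {0..x + 1}) p"
    using x by (auto dest: lipschitz_on_continuous_on simp: continuous_on_eq_continuous_within)
  moreover have "at x within {0..x + 1} = at x within {0..}"
    by (rule at_within_nhd[of x "{..<x + 1}"]) auto
  ultimately show "continuous (at x within {0..}) p" by simp
qed

lemma pressure_exp_lipschitz: "\<exists>L. \<forall>x\<in>{0..R}. L-lipschitz_on {- B..B} (\<lambda>z. p (x * exp (- z)))"
proof -
  obtain A where A: "A-lipschitz_on {0..R * exp B} p" using p_lipschitz by blast
  have "(A * (R * exp B))-lipschitz_on {- B..B} (\<lambda>z. p (x * exp (- z)))" if x: "x \<in> {0..R}" for x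
  proof (rule lipschitz_on_compose2[where f="\<lambda>z. x * exp (- z)" and g=p])
    show "(R * exp B)-lipschitz_on {- B..B} (\<lambda>z. x * exp (- z))"
    proof (rule lipschitz_onI)
      fix z z' assume z: "z \<in> {- B..B}" "z' \<in> {- B..B}"
      have "dist (x * exp (- z)) (x * exp (- z')) = x * norm (exp (- z) - exp (- z'))"
        using x by (simp add: dist_real_def abs_mult flip: right_diff_distrib)
      also have "\<dots> \<le> R * (exp B * norm (- z - - z'))"
        using x z by (intro mult_mono exp_diff_le) auto
      finally show "dist (x * exp (- z)) (x * exp (- z')) \<le> R * exp B * dist z z'"
        by (simp add: dist_real_def abs_minus_commute)
    qed (use x in auto)
    show "A-lipschitz_on ((\<lambda>z. x * exp (- z)) ` {- B..B}) p"
      by (rule lipschitz_on_subset[OF A]) (use x in \<open>auto intro!: mult_mono\<close>)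
  qed
  then show ?thesis by blast
qed

lemma weighted_pressure_exp_lipschitz:
  "\<exists>L. \<forall>x\<in>{0..R}. L-lipschitz_on {- B..B} (\<lambda>z. p (x * exp (- z)) * exp z)"
proof -
  obtain L where L: "\<forall>x\<in>{0..R}. L-lipschitz_on {- B..B} (\<lambda>z. p (x * exp (- z)))"
    using pressure_exp_lipschitz by blast
  obtain S where S: "0 < S" "\<And>x. x \<in> {0..R * exp B} \<Longrightarrow> \<bar>p x\<bar> \<le> S"
    using continuous_on_atLeast_bounded_on_Icc[OF p_cont] by metis
  have "(L * exp B + S * exp B)-lipschitz_on {- B..B} (\<lambda>z. p (x * exp (- z)) * exp z)"
    if x: "x \<in> {0..R}" for x
  proof (rule lipschitz_onI)
    have L_nonneg: "0 \<le> L" using L x lipschitz_on_nonneg by blast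
    then show "0 \<le> L * exp B + S * exp B" using S(1) by simp
    fix z z' assume z: "z \<in> {- B..B}" "z' \<in> {- B..B}"
    have "\<bar>p (x * exp (- z)) - p (x * exp (- z'))\<bar> \<le> L * \<bar>z - z'\<bar>"
      using lipschitz_onD[OF bspec[OF L x] z] by (simp add: dist_real_def)
    moreover have "\<bar>p (x * exp (- z'))\<bar> \<le> S"
      using x z by (intro S(2)) (auto intro!: mult_mono)
    ultimately have "\<bar>p (x * exp (- z)) - p (x * exp (- z'))\<bar> * exp z
          + \<bar>p (x * exp (- z'))\<bar> * norm (exp z - exp z')
        \<le> (L * \<bar>z - z'\<bar>) * exp B + S * (exp B * norm (z - z'))"
      using z L_nonneg S(1) by (intro add_mono mult_mono exp_diff_le) auto
    moreover have "p (x * exp (- z)) * exp z - p (x * exp (- z')) * exp z'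
        = (p (x * exp (- z)) - p (x * exp (- z'))) * exp z + p (x * exp (- z')) * (exp z - exp z')"
      by (simp add: algebra_simps)
    then have "\<bar>p (x * exp (- z)) * exp z - p (x * exp (- z')) * exp z'\<bar>
        \<le> \<bar>p (x * exp (- z)) - p (x * exp (- z'))\<bar> * exp z
          + \<bar>p (x * exp (- z'))\<bar> * norm (exp z - exp z')"
      by (metis abs_exp_cancel abs_mult abs_triangle_ineq real_norm_def)
    ultimately show "dist (p (x * exp (- z)) * exp z) (p (x * exp (- z')) * exp z')
        \<le> (L * exp B + S * exp B) * dist z z'"
      by (simp add: dist_real_def algebra_simps)
  qed
  then show ?thesis by blast
qed

end

locale lagrangian_system = prob_space M + pressure_law p for M :: "'a measure" and p +
  fixes \<rho> :: "'a \<Rightarrow> real" and R :: real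
  assumes \<rho>_meas [measurable]: "\<rho> \<in> borel_measurable M"
    and \<rho>_range: "\<rho> y \<in> {0..R}"
begin

text \<open>If \<open>w y\<close> is the integral of \<open>\<sigma>(s,y)\<close> over \<open>[0,t]\<close>, then \<open>lagrangian_density w\<close>, \<open>relative_pressure w\<close> and
  \<open>lagrangian_mean q w\<close> are \<open>\<eta>(t,.)\<close>, \<open>\<sigma>(t,.)\<close> and \<open>{q(\<eta>)}\<^sub>\<sigma>(t)\<close>.\<close>

definition lagrangian_density :: "('a \<Rightarrow> real) \<Rightarrow> 'a \<Rightarrow> real" where
  "lagrangian_density w y = \<rho> y * exp (- w y)"

definition lagrangian_mean :: "(real \<Rightarrow> real) \<Rightarrow> ('a \<Rightarrow> real) \<Rightarrow> real" where
  "lagrangian_mean q w = (\<integral>y. q (lagrangian_density w y) * exp (w y) \<partial>M)"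

definition relative_pressure :: "('a \<Rightarrow> real) \<Rightarrow> 'a \<Rightarrow> real" where
  "relative_pressure w y = p (lagrangian_density w y) - lagrangian_mean p w"

definition flow_on :: "real \<Rightarrow> (real \<Rightarrow> 'a \<Rightarrow> real) \<Rightarrow> bool" where
  "flow_on T u \<longleftrightarrow> (\<lambda>(t, y). u t y) \<in> borel_measurable (borel \<Otimes>\<^sub>M M) \<and>
    (\<exists>B. \<forall>t\<in>{0..T}. \<forall>y. \<bar>u t y\<bar> \<le> B) \<and>
    (AE y in M. u 0 y = 0 \<and>
      (\<forall>t\<in>{0..T}. ((\<lambda>t. u t y) has_real_derivative relative_pressure (u t) y) (at t within {0..T})))"

lemma lagrangian_density_nonneg: "0 \<le> lagrangian_density w y"
  using \<rho>_range[of y] by (simp add: lagrangian_density_def)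

lemma lagrangian_density_le: "\<bar>w y\<bar> \<le> B \<Longrightarrow> lagrangian_density w y \<le> R * exp B"
  unfolding lagrangian_density_def using \<rho>_range[of y] by (intro mult_mono) auto

lemma borel_measurable_comp_lagrangian_density:
  fixes q :: "real \<Rightarrow> real"
  assumes "continuous_on {0..} q" and [measurable]: "w \<in> borel_measurable M"
  shows "(\<lambda>y. q (lagrangian_density w y)) \<in> borel_measurable M"
proof (rule borel_measurable_comp_continuous_on_nonneg[OF assms(1)])
  show "lagrangian_density w \<in> borel_measurable M"
    unfolding lagrangian_density_def by measurable
qed (rule lagrangian_density_nonneg)

lemma comp_lagrangian_density_bounded_measurable:
  fixes q :: "real \<Rightarrow> real"
  assumes q: "continuous_on {0..} q"
  shows "\<exists>K. \<forall>w\<in>bounded_measurable M B. (\<lambda>y. q (lagrangian_density w y)) \<in> bounded_measurable M K"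
proof -
  obtain K where K: "\<And>x. x \<in> {0..R * exp B} \<Longrightarrow> \<bar>q x\<bar> \<le> K"
    using continuous_on_atLeast_bounded_on_Icc[OF q] by metis
  have "(\<lambda>y. q (lagrangian_density w y)) \<in> bounded_measurable M K"
    if w: "w \<in> bounded_measurable M B" for w
    unfolding bounded_measurable_def
    using borel_measurable_comp_lagrangian_density[OF q bounded_measurableD[OF w]]
    by (auto intro!: K lagrangian_density_nonneg lagrangian_density_le bounded_measurable_abs_le[OF w])
  then show ?thesis by blast
qed

lemma weighted_comp_lagrangian_density_bounded_measurable:
  fixes q :: "real \<Rightarrow> real"
  assumes q: "continuous_on {0..} q"
  shows "\<exists>K. \<forall>w\<in>bounded_measurable M B.
    (\<lambda>y. q (lagrangian_density w y) * exp (w y)) \<in> bounded_measurable M K"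
  using comp_lagrangian_density_bounded_measurable[OF q, of B] bounded_measurable_exp
    bounded_measurable_mult by metis

lemma integrable_lagrangian_mean:
  fixes q :: "real \<Rightarrow> real"
  assumes "continuous_on {0..} q" "w \<in> bounded_measurable M B"
  shows "integrable M (\<lambda>y. q (lagrangian_density w y) * exp (w y))"
  using weighted_comp_lagrangian_density_bounded_measurable[OF assms(1), of B] assms(2)
    integrable_bounded_measurable by blast

lemma lagrangian_mean_bounded:
  assumes "continuous_on {0..} q"
  shows "\<exists>K. \<forall>w\<in>bounded_measurable M B. \<bar>lagrangian_mean q w\<bar> \<le> K"
  unfolding lagrangian_mean_def
  using weighted_comp_lagrangian_density_bounded_measurable[OF assms, of B] abs_expectation_le by meson

lemma relative_pressure_bounded_measurable:
  "\<exists>K. \<forall>w\<in>bounded_measurable M B. relative_pressure w \<in> bounded_measurable M K"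
proof -
  obtain K1 where K1: "\<forall>w\<in>bounded_measurable M B.
      (\<lambda>y. p (lagrangian_density w y)) \<in> bounded_measurable M K1"
    using comp_lagrangian_density_bounded_measurable[OF p_cont] by blast
  obtain K2 where K2: "\<forall>w\<in>bounded_measurable M B. \<bar>lagrangian_mean p w\<bar> \<le> K2"
    using lagrangian_mean_bounded[OF p_cont] by blast
  have "relative_pressure w \<in> bounded_measurable M (K1 + K2)" if "w \<in> bounded_measurable M B" for w
    unfolding relative_pressure_def[abs_def]
    using K1 K2 that by (intro bounded_measurable_diff) (auto simp: bounded_measurable_def)
  then show ?thesis by blast
qed

lemma lagrangian_mean_affine:
  assumes "continuous_on {0..} q" "w \<in> bounded_measurable M B"
  shows "lagrangian_mean (\<lambda>x. a * q x + b) w = a * lagrangian_mean q w + b * lagrangian_mean (\<lambda>_. 1) w"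
  using integrable_lagrangian_mean[OF assms]
    integrable_lagrangian_mean[OF continuous_on_const assms(2), of 1]
  by (simp add: lagrangian_mean_def distrib_right mult.assoc)

lemma lagrangian_mean_mono:
  assumes "continuous_on {0..} q" "continuous_on {0..} q'" "w \<in> bounded_measurable M B"
    and "\<And>x. 0 \<le> x \<Longrightarrow> q x \<le> q' x"
  shows "lagrangian_mean q w \<le> lagrangian_mean q' w"
  unfolding lagrangian_mean_def
  using assms lagrangian_density_nonneg
  by (intro integral_mono integrable_lagrangian_mean mult_right_mono) auto

lemma pressure_lagrangian_density_lipschitz:
  "\<exists>L\<ge>0. \<forall>w\<in>bounded_measurable M B. \<forall>w'\<in>bounded_measurable M B. \<forall>y.
    \<bar>p (lagrangian_density w y) - p (lagrangian_density w' y)\<bar> \<le> L * \<bar>w y - w' y\<bar>"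
proof -
  obtain L where L: "\<forall>x\<in>{0..R}. L-lipschitz_on {- B..B} (\<lambda>z. p (x * exp (- z)))"
    using pressure_exp_lipschitz by blast
  have "\<bar>p (lagrangian_density w y) - p (lagrangian_density w' y)\<bar> \<le> L * \<bar>w y - w' y\<bar>"
    if "w \<in> bounded_measurable M B" "w' \<in> bounded_measurable M B" for w w' y
    using lipschitz_onD[OF bspec[OF L \<rho>_range[of y]], OF that[THEN bounded_measurable_range]]
    by (simp add: dist_real_def lagrangian_density_def)
  moreover have "0 \<le> L" using L \<rho>_range lipschitz_on_nonneg by blast
  ultimately show ?thesis by blast
qed

lemma lagrangian_mean_pressure_lipschitz:
  "\<exists>L\<ge>0. \<forall>w\<in>bounded_measurable M B. \<forall>w'\<in>bounded_measurable M B.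
    \<bar>lagrangian_mean p w - lagrangian_mean p w'\<bar> \<le> L * expectation (\<lambda>y. \<bar>w y - w' y\<bar>)"
proof -
  obtain L where L: "\<forall>x\<in>{0..R}. L-lipschitz_on {- B..B} (\<lambda>z. p (x * exp (- z)) * exp z)"
    using weighted_pressure_exp_lipschitz by blast
  have "\<bar>lagrangian_mean p w - lagrangian_mean p w'\<bar> \<le> L * expectation (\<lambda>y. \<bar>w y - w' y\<bar>)"
    if w: "w \<in> bounded_measurable M B" and w': "w' \<in> bounded_measurable M B" for w w'
  proof -
    let ?f = "\<lambda>w y. p (lagrangian_density w y) * exp (w y)"
    note integrable = integrable_lagrangian_mean[OF p_cont w] integrable_lagrangian_mean[OF p_cont w']
    have diff_integrable: "integrable M (\<lambda>y. \<bar>w y - w' y\<bar>)"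
      by (intro integrable_abs integrable_bounded_measurable[OF bounded_measurable_diff[OF w w']])
    have "\<bar>lagrangian_mean p w - lagrangian_mean p w'\<bar> = \<bar>\<integral>y. ?f w y - ?f w' y \<partial>M\<bar>"
      using integrable by (simp add: lagrangian_mean_def)
    also have "\<dots> \<le> (\<integral>y. \<bar>?f w y - ?f w' y\<bar> \<partial>M)"
      by (rule integral_abs_bound)
    also have "\<dots> \<le> (\<integral>y. L * \<bar>w y - w' y\<bar> \<partial>M)"
    proof (rule integral_mono)
      show "\<bar>?f w y - ?f w' y\<bar> \<le> L * \<bar>w y - w' y\<bar>" for y
        using lipschitz_onD[OF bspec[OF L \<rho>_range[of y]],
            OF w[THEN bounded_measurable_range] w'[THEN bounded_measurable_range]]
        by (simp add: dist_real_def lagrangian_density_def)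
    qed (use integrable diff_integrable in auto)
    finally show ?thesis by simp
  qed
  moreover have "0 \<le> L" using L \<rho>_range lipschitz_on_nonneg by blast
  ultimately show ?thesis by blast
qed

lemma relative_pressure_lipschitz:
  "\<exists>L\<ge>0. \<forall>w\<in>bounded_measurable M B. \<forall>w'\<in>bounded_measurable M B. \<forall>y.
    \<bar>relative_pressure w y - relative_pressure w' y\<bar>
      \<le> L * (\<bar>w y - w' y\<bar> + expectation (\<lambda>y. \<bar>w y - w' y\<bar>))"
proof -
  obtain L1 where L1: "0 \<le> L1" "\<forall>w\<in>bounded_measurable M B. \<forall>w'\<in>bounded_measurable M B. \<forall>y.
      \<bar>p (lagrangian_density w y) - p (lagrangian_density w' y)\<bar> \<le> L1 * \<bar>w y - w' y\<bar>"
    using pressure_lagrangian_density_lipschitz by blast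
  obtain L2 where L2: "0 \<le> L2" "\<forall>w\<in>bounded_measurable M B. \<forall>w'\<in>bounded_measurable M B.
      \<bar>lagrangian_mean p w - lagrangian_mean p w'\<bar> \<le> L2 * expectation (\<lambda>y. \<bar>w y - w' y\<bar>)"
    using lagrangian_mean_pressure_lipschitz by blast
  have "\<bar>relative_pressure w y - relative_pressure w' y\<bar>
      \<le> (L1 + L2) * (\<bar>w y - w' y\<bar> + expectation (\<lambda>y. \<bar>w y - w' y\<bar>))"
    if "w \<in> bounded_measurable M B" "w' \<in> bounded_measurable M B" for w w' y
  proof -
    let ?A = "expectation (\<lambda>y. \<bar>w y - w' y\<bar>)"
    have "\<bar>relative_pressure w y - relative_pressure w' y\<bar> \<le> L1 * \<bar>w y - w' y\<bar> + L2 * ?A"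
      using bspec[OF bspec[OF L1(2) that(1)] that(2), rule_format, of y]
        bspec[OF bspec[OF L2(2) that(1)] that(2)]
      unfolding relative_pressure_def by linarith
    also have "\<dots> \<le> (L1 + L2) * \<bar>w y - w' y\<bar> + (L1 + L2) * ?A"
      using L1(1) L2(1) by (intro add_mono mult_right_mono) auto
    finally show ?thesis by (simp add: distrib_left)
  qed
  then show ?thesis using L1(1) L2(1) by (intro exI[of _ "L1 + L2"]) auto
qed

lemma flow_measurable: "flow_on T u \<Longrightarrow> u t \<in> borel_measurable M"
  unfolding flow_on_def using measurable_Pair2[of "\<lambda>(t, y). u t y" borel M borel t] by auto

lemma flow_bounded_measurable:
  assumes "flow_on T u"
  obtains B where "\<And>t. t \<in> {0..T} \<Longrightarrow> u t \<in> bounded_measurable M B"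
proof -
  obtain B where "\<forall>t\<in>{0..T}. \<forall>y. \<bar>u t y\<bar> \<le> B" using assms unfolding flow_on_def by blast
  then show thesis
    using flow_measurable[OF assms] by (intro that[of B]) (simp add: bounded_measurable_def)
qed

lemma flow_derivative:
  assumes "flow_on T u"
  shows "AE y in M. u 0 y = 0 \<and>
    (\<forall>t\<in>{0..T}. ((\<lambda>t. u t y) has_real_derivative relative_pressure (u t) y) (at t within {0..T}))"
  using assms by (simp add: flow_on_def)

lemma flow_density_and_pressure_bounded:
  assumes "flow_on T u"
  shows "\<exists>A K. \<forall>t\<in>{0..T}. \<forall>y. \<bar>lagrangian_density (u t) y\<bar> \<le> A \<and> \<bar>relative_pressure (u t) y\<bar> \<le> K"
proof -
  obtain B where B: "\<And>t. t \<in> {0..T} \<Longrightarrow> u t \<in> bounded_measurable M B"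
    using flow_bounded_measurable[OF assms] by metis
  obtain K where K: "\<forall>w\<in>bounded_measurable M B. relative_pressure w \<in> bounded_measurable M K"
    using relative_pressure_bounded_measurable by blast
  have "\<bar>lagrangian_density (u t) y\<bar> \<le> R * exp B" if "t \<in> {0..T}" for t y
    using lagrangian_density_nonneg[of "u t" y] lagrangian_density_le[of "u t" y B]
      bounded_measurable_abs_le[OF B[OF that]] by simp
  moreover have "\<bar>relative_pressure (u t) y\<bar> \<le> K" if "t \<in> {0..T}" for t y
    using K B[OF that] by (blast intro: bounded_measurable_abs_le)
  ultimately show ?thesis by blast
qed

end

section \<open>Conservation of mass\<close>

context lagrangian_system
begin

lemma flow_lagrangian_mean_initial:
  fixes q :: "real \<Rightarrow> real"
  assumes "flow_on T u" "continuous_on {0..} q"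
  shows "lagrangian_mean q (u 0) = expectation (\<lambda>y. q (\<rho> y))"
proof -
  have "lagrangian_mean q (u 0) = lagrangian_mean q (\<lambda>y. 0)"
    unfolding lagrangian_mean_def
  proof (rule integral_cong_AE)
    show "AE y in M. q (lagrangian_density (u 0) y) * exp (u 0 y)
        = q (lagrangian_density (\<lambda>y. 0) y) * exp 0"
      using flow_derivative[OF assms(1)] by eventually_elim (simp add: lagrangian_density_def)
  qed (use flow_measurable[OF assms(1)] borel_measurable_comp_lagrangian_density[OF assms(2)] in auto)
  then show ?thesis by (simp add: lagrangian_mean_def lagrangian_density_def)
qed

text \<open>In the applications \<open>\<theta> x = q x - x q'(x)\<close>, which may be continuous at 0 when \<open>q'\<close> is not.\<close>

lemma flow_lagrangian_mean_derivative:
  assumes flow: "flow_on T u" and q: "continuous_on {0..} q" and \<theta>: "continuous_on {0..} \<theta>"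
    and deriv: "\<And>x z. 0 \<le> x \<Longrightarrow>
      ((\<lambda>z. q (x * exp (- z)) * exp z) has_real_derivative \<theta> (x * exp (- z)) * exp z) (at z)"
    and t: "t \<in> {0..T}"
  shows "((\<lambda>t. lagrangian_mean q (u t)) has_real_derivative
    lagrangian_mean (\<lambda>x. \<theta> x * (p x - lagrangian_mean p (u t))) (u t)) (at t within {0..T})"
proof -
  obtain B where B: "\<And>t. t \<in> {0..T} \<Longrightarrow> u t \<in> bounded_measurable M B"
    using flow_bounded_measurable[OF flow] by metis
  obtain K K'
    where K: "\<forall>w\<in>bounded_measurable M B.
        (\<lambda>y. \<theta> (lagrangian_density w y) * exp (w y)) \<in> bounded_measurable M K"
      and K': "\<forall>w\<in>bounded_measurable M B. relative_pressure w \<in> bounded_measurable M K'"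
    using weighted_comp_lagrangian_density_bounded_measurable[OF \<theta>]
      relative_pressure_bounded_measurable by metis
  let ?g = "\<lambda>t y. q (lagrangian_density (u t) y) * exp (u t y)"
  let ?g' = "\<lambda>t y. \<theta> (lagrangian_density (u t) y) * exp (u t y) * relative_pressure (u t) y"
  have g'_bounded: "?g' t \<in> bounded_measurable M (K * K')" if "t \<in> {0..T}" for t
    using K K' B[OF that] by (intro bounded_measurable_mult) auto
  have "((\<lambda>t. \<integral>y. ?g t y \<partial>M) has_real_derivative (\<integral>y. ?g' t y \<partial>M)) (at t within {0..T})"
  proof (rule has_real_derivative_lebesgue_integral[OF _ _ _ _ t])
    show "AE y in M. \<forall>t\<in>{0..T}. \<bar>?g' t y\<bar> \<le> K * K' \<and>
        ((\<lambda>t. ?g t y) has_real_derivative ?g' t y) (at t within {0..T})"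
      using flow_derivative[OF flow]
    proof eventually_elim
      case (elim y)
      show ?case
      proof (intro ballI conjI)
        fix t assume t: "t \<in> {0..T}"
        show "\<bar>?g' t y\<bar> \<le> K * K'"
          by (rule bounded_measurable_abs_le[OF g'_bounded[OF t]])
        have "((\<lambda>t. u t y) has_real_derivative relative_pressure (u t) y) (at t within {0..T})"
          using elim t by blast
        from DERIV_chain2[OF deriv this, of "\<rho> y"]
        show "((\<lambda>t. ?g t y) has_real_derivative ?g' t y) (at t within {0..T})"
          using \<rho>_range[of y] by (simp add: lagrangian_density_def)
      qed
    qed
  next
    fix t assume t: "t \<in> {0..T}"
    show "integrable M (?g t)" by (rule integrable_lagrangian_mean[OF q B[OF t]])
    show "?g' t \<in> borel_measurable M" by (rule bounded_measurableD[OF g'_bounded[OF t]])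
  qed simp
  then show ?thesis
    by (simp add: lagrangian_mean_def relative_pressure_def mult_ac)
qed

lemma flow_mass_conserved:
  assumes flow: "flow_on T u" and t: "t \<in> {0..T}"
  shows "lagrangian_mean (\<lambda>_. 1) (u t) = 1"
proof -
  define I where "I t = lagrangian_mean (\<lambda>_. 1) (u t)" for t
  let ?m = "\<lambda>t. lagrangian_mean p (u t)"
  obtain B where B: "\<And>t. t \<in> {0..T} \<Longrightarrow> u t \<in> bounded_measurable M B"
    using flow_bounded_measurable[OF flow] by metis
  obtain K where K: "\<forall>w\<in>bounded_measurable M B. \<bar>lagrangian_mean p w\<bar> \<le> K"
    using lagrangian_mean_bounded[OF p_cont] by blast
  have I_deriv: "(I has_real_derivative ?m t * (1 - I t)) (at t within {0..T})" if t: "t \<in> {0..T}" for t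
  proof -
    have "(I has_real_derivative lagrangian_mean (\<lambda>x. 1 * (p x - ?m t)) (u t)) (at t within {0..T})"
      unfolding I_def
      by (rule flow_lagrangian_mean_derivative[OF flow _ _ _ t]) (auto intro!: derivative_eq_intros)
    moreover have "lagrangian_mean (\<lambda>x. 1 * (p x - ?m t)) (u t) = ?m t * (1 - I t)"
      using lagrangian_mean_affine[OF p_cont B[OF t], of 1 "- ?m t"] by (simp add: I_def algebra_simps)
    ultimately show ?thesis by simp
  qed
  have "(1 - I t)\<^sup>2 \<le> (1 - I 0)\<^sup>2 * exp (2 * K * (t - 0))"
  proof (rule gronwall[OF _ _ t])
    fix s assume s: "s \<in> {0..T}"
    show "((\<lambda>t. (1 - I t)\<^sup>2) has_real_derivative - 2 * ?m s * (1 - I s)\<^sup>2) (at s within {0..T})"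
      by (auto intro!: derivative_eq_intros I_deriv[OF s] simp: power2_eq_square)
    show "- 2 * ?m s * (1 - I s)\<^sup>2 \<le> 2 * K * (1 - I s)\<^sup>2"
      using bspec[OF K B[OF s]] by (intro mult_right_mono) auto
  qed
  moreover have "I 0 = 1"
    unfolding I_def using flow_lagrangian_mean_initial[OF flow, of "\<lambda>_. 1"] by (simp add: prob_space)
  ultimately show ?thesis by (simp add: I_def)
qed

section \<open>Uniqueness of flows\<close>

lemma relative_pressure_one_sided_lipschitz:
  "\<exists>L. \<forall>w\<in>bounded_measurable M B. \<forall>w'\<in>bounded_measurable M B.
    expectation (\<lambda>y. (w y - w' y) * (relative_pressure w y - relative_pressure w' y))
      \<le> L * expectation (\<lambda>y. (w y - w' y)\<^sup>2)"
proof -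
  obtain L where L: "0 \<le> L" "\<forall>w\<in>bounded_measurable M B. \<forall>w'\<in>bounded_measurable M B. \<forall>y.
      \<bar>relative_pressure w y - relative_pressure w' y\<bar>
        \<le> L * (\<bar>w y - w' y\<bar> + expectation (\<lambda>y. \<bar>w y - w' y\<bar>))"
    using relative_pressure_lipschitz by blast
  obtain K where K: "\<forall>w\<in>bounded_measurable M B. relative_pressure w \<in> bounded_measurable M K"
    using relative_pressure_bounded_measurable by blast
  have "expectation (\<lambda>y. (w y - w' y) * (relative_pressure w y - relative_pressure w' y))
      \<le> (2 * L) * expectation (\<lambda>y. (w y - w' y)\<^sup>2)"
    if w: "w \<in> bounded_measurable M B" and w': "w' \<in> bounded_measurable M B" for w w'
  proof -
    let ?d = "\<lambda>y. w y - w' y" and ?r = "\<lambda>y. relative_pressure w y - relative_pressure w' y"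
    let ?A = "expectation (\<lambda>y. \<bar>?d y\<bar>)"
    have diff_bounded: "?d \<in> bounded_measurable M (B + B)" using w w' by (rule bounded_measurable_diff)
    have "?r \<in> bounded_measurable M (K + K)" using K w w' by (intro bounded_measurable_diff) auto
    then have integrable: "integrable M ?d" "integrable M (\<lambda>y. (?d y)\<^sup>2)"
      "integrable M (\<lambda>y. ?d y * ?r y)"
      using diff_bounded bounded_measurable_mult[OF diff_bounded diff_bounded]
        bounded_measurable_mult[OF diff_bounded]
      by (auto simp: power2_eq_square intro: integrable_bounded_measurable)
    have "?d y * ?r y \<le> L * (?d y)\<^sup>2 + L * ?A * \<bar>?d y\<bar>" for y
    proof -
      have "\<bar>?d y * ?r y\<bar> \<le> \<bar>?d y\<bar> * (L * (\<bar>?d y\<bar> + ?A))"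
        unfolding abs_mult using L(2) w w' by (intro mult_left_mono) auto
      also have "\<dots> = L * (\<bar>?d y\<bar> * \<bar>?d y\<bar>) + L * ?A * \<bar>?d y\<bar>"
        by (simp only: distrib_left mult_ac)
      finally show ?thesis by (simp add: power2_eq_square)
    qed
    then have "expectation (\<lambda>y. ?d y * ?r y) \<le> expectation (\<lambda>y. L * (?d y)\<^sup>2 + L * ?A * \<bar>?d y\<bar>)"
      using integrable by (intro integral_mono) auto
    also have "\<dots> = L * expectation (\<lambda>y. (?d y)\<^sup>2) + L * ?A\<^sup>2"
      using integrable by (simp add: power2_eq_square)
    also have "\<dots> \<le> L * expectation (\<lambda>y. (?d y)\<^sup>2) + L * expectation (\<lambda>y. (?d y)\<^sup>2)"
      using L(1) integrable square_expectation_le[of "\<lambda>y. \<bar>?d y\<bar>"]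
      by (intro add_left_mono mult_left_mono) auto
    finally show ?thesis by simp
  qed
  then show ?thesis by blast
qed

lemma flow_mean_square_diff_derivative:
  assumes u: "flow_on T u" and v: "flow_on T v" and t: "t \<in> {0..T}"
  shows "((\<lambda>t. expectation (\<lambda>y. (u t y - v t y)\<^sup>2)) has_real_derivative
    2 * expectation (\<lambda>y. (u t y - v t y) * (relative_pressure (u t) y - relative_pressure (v t) y)))
    (at t within {0..T})"
proof -
  obtain B C where B: "\<And>t. t \<in> {0..T} \<Longrightarrow> u t \<in> bounded_measurable M B"
    and C: "\<And>t. t \<in> {0..T} \<Longrightarrow> v t \<in> bounded_measurable M C"
    using flow_bounded_measurable[OF u] flow_bounded_measurable[OF v] by metis
  obtain K K' where K: "\<forall>w\<in>bounded_measurable M B. relative_pressure w \<in> bounded_measurable M K"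
    and K': "\<forall>w\<in>bounded_measurable M C. relative_pressure w \<in> bounded_measurable M K'"
    using relative_pressure_bounded_measurable by metis
  let ?d = "\<lambda>t y. u t y - v t y" and ?r = "\<lambda>t y. relative_pressure (u t) y - relative_pressure (v t) y"
  have diff_bounded: "?d t \<in> bounded_measurable M (B + C)" if "t \<in> {0..T}" for t
    by (rule bounded_measurable_diff[OF B[OF that] C[OF that]])
  have product_bounded: "(\<lambda>y. ?d t y * ?r t y) \<in> bounded_measurable M ((B + C) * (K + K'))"
    if "t \<in> {0..T}" for t
    using K K' B[OF that] C[OF that]
    by (intro bounded_measurable_mult diff_bounded bounded_measurable_diff that) auto
  have "((\<lambda>t. expectation (\<lambda>y. (?d t y)\<^sup>2)) has_real_derivative expectation (\<lambda>y. 2 * (?d t y * ?r t y)))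
    (at t within {0..T})"
  proof (rule has_real_derivative_lebesgue_integral[OF _ _ _ _ t])
    fix t assume t: "t \<in> {0..T}"
    show "integrable M (\<lambda>y. (?d t y)\<^sup>2)"
      unfolding power2_eq_square
      by (rule integrable_bounded_measurable[OF bounded_measurable_mult
            [OF diff_bounded[OF t] diff_bounded[OF t]]])
    show "(\<lambda>y. 2 * (?d t y * ?r t y)) \<in> borel_measurable M"
      using bounded_measurableD[OF product_bounded[OF t]] by measurable
  next
    show "AE y in M. \<forall>t\<in>{0..T}. \<bar>2 * (?d t y * ?r t y)\<bar> \<le> 2 * ((B + C) * (K + K')) \<and>
      ((\<lambda>t. (?d t y)\<^sup>2) has_real_derivative 2 * (?d t y * ?r t y)) (at t within {0..T})"
      using flow_derivative[OF u] flow_derivative[OF v]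
    proof eventually_elim
      case (elim y)
      show ?case
      proof (intro ballI conjI)
        fix t assume t: "t \<in> {0..T}"
        show "\<bar>2 * (?d t y * ?r t y)\<bar> \<le> 2 * ((B + C) * (K + K'))"
          using bounded_measurable_abs_le[OF product_bounded[OF t], of y] by simp
        show "((\<lambda>t. (?d t y)\<^sup>2) has_real_derivative 2 * (?d t y * ?r t y)) (at t within {0..T})"
          using elim t by (auto intro!: derivative_eq_intros)
      qed
    qed
  qed simp
  then show ?thesis by simp
qed

lemma flow_unique:
  assumes u: "flow_on T u" and v: "flow_on T v" and t: "t \<in> {0..T}"
  shows "AE y in M. u t y = v t y"
proof -
  obtain Bu Bv where "\<And>t. t \<in> {0..T} \<Longrightarrow> u t \<in> bounded_measurable M Bu"
    "\<And>t. t \<in> {0..T} \<Longrightarrow> v t \<in> bounded_measurable M Bv"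
    using flow_bounded_measurable[OF u] flow_bounded_measurable[OF v] by metis
  then obtain B where B: "\<And>t. t \<in> {0..T} \<Longrightarrow> u t \<in> bounded_measurable M B"
    "\<And>t. t \<in> {0..T} \<Longrightarrow> v t \<in> bounded_measurable M B"
    by (metis bounded_measurable_mono max.cobounded1 max.cobounded2)
  obtain L where L: "\<forall>w\<in>bounded_measurable M B. \<forall>w'\<in>bounded_measurable M B.
      expectation (\<lambda>y. (w y - w' y) * (relative_pressure w y - relative_pressure w' y))
        \<le> L * expectation (\<lambda>y. (w y - w' y)\<^sup>2)"
    using relative_pressure_one_sided_lipschitz by blast
  define E where "E t = expectation (\<lambda>y. (u t y - v t y)\<^sup>2)" for t
  have "E t \<le> E 0 * exp (2 * L * (t - 0))"
  proof (rule gronwall[OF _ _ t])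
    fix s assume s: "s \<in> {0..T}"
    let ?E' = "2 * expectation
      (\<lambda>y. (u s y - v s y) * (relative_pressure (u s) y - relative_pressure (v s) y))"
    show "(E has_real_derivative ?E') (at s within {0..T})"
      unfolding E_def by (rule flow_mean_square_diff_derivative[OF u v s])
    show "?E' \<le> 2 * L * E s"
      using bspec[OF bspec[OF L B(1)[OF s]] B(2)[OF s]] by (simp add: E_def)
  qed
  moreover have "E 0 = 0"
    unfolding E_def
  proof (rule integral_eq_zero_AE)
    show "AE y in M. (u 0 y - v 0 y)\<^sup>2 = 0"
      using flow_derivative[OF u] flow_derivative[OF v] by eventually_elim simp
  qed
  ultimately have "E t = 0" unfolding E_def by (simp add: order_antisym)
  moreover have "integrable M (\<lambda>y. (u t y - v t y)\<^sup>2)"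
    unfolding power2_eq_square
    by (rule integrable_bounded_measurable[OF bounded_measurable_mult
          [OF bounded_measurable_diff bounded_measurable_diff]]; rule B[OF t])
  ultimately have "AE y in M. (u t y - v t y)\<^sup>2 = 0"
    using integral_nonneg_eq_0_iff_AE[of M "\<lambda>y. (u t y - v t y)\<^sup>2"] by (simp add: E_def)
  then show ?thesis by simp
qed

end

section \<open>A priori bounds for coercive pressure laws\<close>

locale coercive_pressure = pressure_law +
  fixes C C2 :: real and P :: "real \<Rightarrow> real"
  assumes C_pos: "0 < C"
    and p_lower: "\<And>x. 0 \<le> x \<Longrightarrow> - C \<le> p x"
    and p_unbounded: "\<And>K. \<exists>x\<ge>0. K < p x"
    and P_cont: "continuous_on {0..} P"
    and P_deriv: "\<And>x. 0 < x \<Longrightarrow> (P has_real_derivative (p x + P x - C2) / x) (at x)"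
    and P_0: "P 0 = C2 - p 0"
    and p_le_P: "\<And>x. 0 \<le> x \<Longrightarrow> p x \<le> C * P x"
begin

lemma potential_exp_derivative:
  assumes "0 \<le> x"
  shows "((\<lambda>z. P (x * exp (- z)) * exp z) has_real_derivative (C2 - p (x * exp (- z))) * exp z) (at z)"
proof (cases "x = 0")
  case True
  then show ?thesis by (auto intro!: derivative_eq_intros simp: P_0)
next
  case False
  define e where "e = x * exp (- z)"
  have e_pos: "0 < e" using assms False by (simp add: e_def)
  have "((\<lambda>z. x * exp (- z)) has_real_derivative - e) (at z)"
    unfolding e_def by (auto intro!: derivative_eq_intros)
  then have "((\<lambda>z. P (x * exp (- z))) has_real_derivative (p e + P e - C2) / e * (- e)) (at z)"
    using P_deriv[OF e_pos] unfolding e_def by (intro DERIV_chain2[where f=P])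
  then have "((\<lambda>z. P (x * exp (- z))) has_real_derivative - (p e + P e - C2)) (at z)"
    using e_pos by simp
  then show ?thesis
    by (auto intro!: derivative_eq_intros simp: algebra_simps simp flip: e_def)
qed

end

lemma exp_trajectory_le_barrier:
  fixes z m p :: "real \<Rightarrow> real"
  assumes deriv: "\<And>t. t \<in> {a..b} \<Longrightarrow>
      (z has_real_derivative p (x * exp (- z t)) - m t) (at t within {a..b})"
    and "x * exp (- z a) \<le> r" "0 < r" and mean_less: "\<And>t. t \<in> {a..b} \<Longrightarrow> m t < p r" and t: "t \<in> {a..b}"
  shows "x * exp (- z t) \<le> r"
proof (rule le_if_decreasing_at_level[where f="\<lambda>t. x * exp (- z t)", OF _ assms(2) _ t])
  have exp_deriv: "((\<lambda>t. x * exp (- z t)) has_real_derivative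
    - (x * exp (- z t)) * (p (x * exp (- z t)) - m t)) (at t within {a..b})" if "t \<in> {a..b}" for t
    using deriv[OF that] by (auto intro!: derivative_eq_intros simp: algebra_simps)
  then show "continuous_on {a..b} (\<lambda>t. x * exp (- z t))" by (rule DERIV_continuous_on)
  fix t assume t: "t \<in> {a..b}" and "x * exp (- z t) = r"
  then show "\<exists>l<0. ((\<lambda>t. x * exp (- z t)) has_real_derivative l) (at t within {a..b})"
    using exp_deriv[OF t] mean_less[OF t] \<open>0 < r\<close> by (intro exI[of _ "- r * (p r - m t)"]) auto
qed

locale coercive_lagrangian_system = lagrangian_system + coercive_pressure
begin

definition initial_energy :: real where
  "initial_energy = expectation (\<lambda>y. P (\<rho> y))"

definition is_barrier :: "real \<Rightarrow> bool" where
  "is_barrier r \<longleftrightarrow> R \<le> r \<and> 0 < r \<and> C * initial_energy < p r"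

lemma barrier_exists: "\<exists>r. is_barrier r"
proof -
  obtain S where S: "\<And>x. x \<in> {0..max R 1} \<Longrightarrow> \<bar>p x\<bar> \<le> S"
    using continuous_on_atLeast_bounded_on_Icc[OF p_cont] by metis
  obtain r where r: "0 \<le> r" "max (C * initial_energy) S < p r" using p_unbounded by blast
  then have "\<not> r \<le> max R 1" using S[of r] by auto
  then have "is_barrier r" using r by (auto simp: is_barrier_def)
  then show ?thesis by blast
qed

lemma flow_energy_le:
  assumes flow: "flow_on T u" and t: "t \<in> {0..T}"
  shows "lagrangian_mean P (u t) \<le> initial_energy"
proof -
  obtain B where B: "\<And>t. t \<in> {0..T} \<Longrightarrow> u t \<in> bounded_measurable M B"
    using flow_bounded_measurable[OF flow] by metis
  have cont: "continuous_on {0..} (\<lambda>x. C2 - p x)" by (intro continuous_intros p_cont)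
  have "lagrangian_mean P (u t) \<le> lagrangian_mean P (u 0) * exp (0 * (t - 0))"
  proof (rule gronwall[OF _ _ t])
    fix s assume s: "s \<in> {0..T}"
    let ?m = "lagrangian_mean p (u s)"
    show "((\<lambda>t. lagrangian_mean P (u t)) has_real_derivative
      lagrangian_mean (\<lambda>x. (C2 - p x) * (p x - ?m)) (u s)) (at s within {0..T})"
      by (rule flow_lagrangian_mean_derivative[OF flow P_cont cont potential_exp_derivative s])
    have "lagrangian_mean (\<lambda>x. (C2 - p x) * (p x - ?m)) (u s)
        \<le> lagrangian_mean (\<lambda>x. (C2 - ?m) * p x + - (C2 - ?m) * ?m) (u s)"
    proof (rule lagrangian_mean_mono[OF _ _ B[OF s]])
      fix x
      have "(C2 - ?m) * p x + - (C2 - ?m) * ?m - (C2 - p x) * (p x - ?m) = (p x - ?m)\<^sup>2"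
        by (simp add: algebra_simps power2_eq_square)
      then show "(C2 - p x) * (p x - ?m) \<le> (C2 - ?m) * p x + - (C2 - ?m) * ?m"
        by (smt (verit) zero_le_power2)
    qed (intro continuous_intros p_cont)+
    also have "\<dots> = 0"
      using lagrangian_mean_affine[OF p_cont B[OF s], of "C2 - ?m" "- (C2 - ?m) * ?m"]
        flow_mass_conserved[OF flow s] by (simp add: algebra_simps)
    finally show "lagrangian_mean (\<lambda>x. (C2 - p x) * (p x - ?m)) (u s) \<le> 0 * lagrangian_mean P (u s)"
      by simp
  qed
  then show ?thesis
    using flow_lagrangian_mean_initial[OF flow P_cont] by (simp add: initial_energy_def)
qed

lemma flow_mean_pressure_bounds:
  assumes flow: "flow_on T u" and t: "t \<in> {0..T}"
  shows "- C \<le> lagrangian_mean p (u t)" "lagrangian_mean p (u t) \<le> C * initial_energy"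
proof -
  obtain B where B: "\<And>t. t \<in> {0..T} \<Longrightarrow> u t \<in> bounded_measurable M B"
    using flow_bounded_measurable[OF flow] by metis
  have "lagrangian_mean (\<lambda>x. 0 * p x + - C) (u t) \<le> lagrangian_mean p (u t)"
    using p_lower by (intro lagrangian_mean_mono[OF _ _ B[OF t]] continuous_intros p_cont) auto
  then show "- C \<le> lagrangian_mean p (u t)"
    using lagrangian_mean_affine[OF p_cont B[OF t], of 0 "- C"] flow_mass_conserved[OF flow t] by simp
  have "lagrangian_mean p (u t) \<le> lagrangian_mean (\<lambda>x. C * P x + 0) (u t)"
    using p_le_P by (intro lagrangian_mean_mono[OF _ _ B[OF t]] continuous_intros p_cont P_cont) auto
  also have "\<dots> = C * lagrangian_mean P (u t)"
    using lagrangian_mean_affine[OF P_cont B[OF t], of C 0] by simp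
  also have "\<dots> \<le> C * initial_energy"
    using flow_energy_le[OF flow t] C_pos by simp
  finally show "lagrangian_mean p (u t) \<le> C * initial_energy" .
qed

lemma flow_density_le_barrier:
  assumes flow: "flow_on T u" and r: "is_barrier r"
  shows "AE y in M. \<forall>t\<in>{0..T}. lagrangian_density (u t) y \<le> r"
  using flow_derivative[OF flow]
proof eventually_elim
  case (elim y)
  have "\<rho> y * exp (- u t y) \<le> r" if t: "t \<in> {0..T}" for t
  proof (rule exp_trajectory_le_barrier[where z="\<lambda>t. u t y" and p=p, OF _ _ _ _ t])
    show "lagrangian_mean p (u s) < p r" if "s \<in> {0..T}" for s
      using flow_mean_pressure_bounds(2)[OF flow that] r by (simp add: is_barrier_def)
  qed (use elim r \<rho>_range[of y] in \<open>auto simp: relative_pressure_def lagrangian_density_def is_barrier_def\<close>)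
  then show ?case by (simp add: lagrangian_density_def)
qed

end

section \<open>Existence of flows\<close>

lemma continuous_on_apply_bcontfun_prod:
  "continuous_on UNIV
    (\<lambda>z :: ('a::topological_space \<Rightarrow>\<^sub>C 'b::metric_space) \<times> 'a. apply_bcontfun (fst z) (snd z))"
  unfolding continuous_on_def
proof (intro ballI)
  fix z0 :: "('a \<Rightarrow>\<^sub>C 'b) \<times> 'a"
  let ?f = "apply_bcontfun (fst z0)"
  have "continuous_on UNIV (\<lambda>z :: ('a \<Rightarrow>\<^sub>C 'b) \<times> 'a. ?f (snd z))"
    by (intro continuous_on_compose2[OF continuous_on_apply_bcontfun[of UNIV]] continuous_intros) auto
  then have "((\<lambda>z. ?f (snd z)) \<longlongrightarrow> ?f (snd z0)) (at z0)"
    unfolding continuous_on_def by blast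
  then have dist_tendsto:
    "((\<lambda>z. dist (fst z) (fst z0) + dist (?f (snd z)) (?f (snd z0))) \<longlongrightarrow> 0) (at z0)"
    by (auto intro!: tendsto_eq_intros)
  have dist_le: "norm (dist (apply_bcontfun (fst z) (snd z)) (?f (snd z0)))
      \<le> dist (fst z) (fst z0) + dist (?f (snd z)) (?f (snd z0))" for z
    using dist_triangle[of "apply_bcontfun (fst z) (snd z)" "?f (snd z0)" "?f (snd z)"]
      dist_bounded[of "fst z" "snd z" "fst z0"] by simp
  have "((\<lambda>z. dist (apply_bcontfun (fst z) (snd z)) (?f (snd z0))) \<longlongrightarrow> 0) (at z0)"
    by (rule Lim_null_comparison[OF always_eventually[OF allI[OF dist_le]] dist_tendsto])
  then show "((\<lambda>z. apply_bcontfun (fst z) (snd z)) \<longlongrightarrow> ?f (snd z0)) (at z0)"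
    by (rule tendsto_dist_iff[THEN iffD2])
qed

context lagrangian_system
begin

lemma R_nonneg: "0 \<le> R"
  using \<rho>_range[of undefined] by simp

lemma clamp_R: "clamp 0 R x \<in> {0..R}"
  using clamp_in_interval[of 0 R x] R_nonneg by simp

abbreviation pullback :: "(real \<Rightarrow>\<^sub>C real) \<Rightarrow> 'a \<Rightarrow> real" where
  "pullback v \<equiv> \<lambda>y. apply_bcontfun v (\<rho> y)"

definition velocity :: "(real \<Rightarrow>\<^sub>C real) \<Rightarrow> (real \<Rightarrow>\<^sub>C real)" where
  "velocity v = Bcontfun (\<lambda>x. p (clamp 0 R x * exp (- apply_bcontfun v x))
    - lagrangian_mean p (pullback v))"

lemma pullback_measurable [measurable]: "pullback v \<in> borel_measurable M"
  by (rule measurable_compose[OF \<rho>_meas borel_measurable_continuous_onI]) simp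

lemma pullback_bounded_measurable: "norm v \<le> B \<Longrightarrow> pullback v \<in> bounded_measurable M B"
  using order_trans[OF norm_bounded[of v]] pullback_measurable[of v]
  by (simp add: bounded_measurable_def)

lemma apply_velocity:
  "apply_bcontfun (velocity v) x
    = p (clamp 0 R x * exp (- apply_bcontfun v x)) - lagrangian_mean p (pullback v)"
proof -
  let ?f = "\<lambda>x. p (clamp 0 R x * exp (- apply_bcontfun v x)) - lagrangian_mean p (pullback v)"
  obtain K where K: "\<And>x. x \<in> {0..R * exp (norm v)} \<Longrightarrow> \<bar>p x\<bar> \<le> K"
    using continuous_on_atLeast_bounded_on_Icc[OF p_cont] by metis
  have "?f \<in> bcontfun"
  proof (rule bcontfun_normI)
    have "continuous_on UNIV (clamp 0 R)"
      using clamp_continuous_on[of 0 R "\<lambda>x. x"] by simp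
    then show "continuous_on UNIV ?f"
      using clamp_R by (intro continuous_intros continuous_on_compose2[OF p_cont]) auto
    fix x
    have "exp (- apply_bcontfun v x) \<le> exp (norm v)"
      using norm_bounded[of v x] by simp
    then have "clamp 0 R x * exp (- apply_bcontfun v x) \<in> {0..R * exp (norm v)}"
      using clamp_R[of x] by (auto intro!: mult_mono)
    from K[OF this] show "norm (?f x) \<le> K + \<bar>lagrangian_mean p (pullback v)\<bar>"
      unfolding real_norm_def by linarith
  qed
  then show ?thesis by (simp add: velocity_def Bcontfun_inverse)
qed

lemma velocity_lipschitz: "\<exists>L. L-lipschitz_on (cball 0 B) velocity"
proof -
  obtain L where L: "\<forall>x\<in>{0..R}. L-lipschitz_on {- B..B} (\<lambda>z. p (x * exp (- z)))"
    using pressure_exp_lipschitz by blast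
  then have L_nonneg: "0 \<le> L" using \<rho>_range lipschitz_on_nonneg by blast
  obtain L' where L': "0 \<le> L'" "\<forall>w\<in>bounded_measurable M B. \<forall>w'\<in>bounded_measurable M B.
      \<bar>lagrangian_mean p w - lagrangian_mean p w'\<bar> \<le> L' * expectation (\<lambda>y. \<bar>w y - w' y\<bar>)"
    using lagrangian_mean_pressure_lipschitz by blast
  have "(L + L')-lipschitz_on (cball 0 B) velocity"
  proof (rule lipschitz_onI)
    fix v w :: "real \<Rightarrow>\<^sub>C real" assume vw: "v \<in> cball 0 B" "w \<in> cball 0 B"
    have diff_le: "\<bar>apply_bcontfun v x - apply_bcontfun w x\<bar> \<le> dist v w" for x
      using dist_bounded[of v x w] by (simp add: dist_real_def)
    have "\<bar>lagrangian_mean p (pullback v) - lagrangian_mean p (pullback w)\<bar>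
        \<le> L' * expectation (\<lambda>y. \<bar>pullback v y - pullback w y\<bar>)"
      using vw L'(2) pullback_bounded_measurable[of v B] pullback_bounded_measurable[of w B] by simp
    also have "\<dots> \<le> L' * dist v w"
      using diff_le
      by (intro mult_left_mono[OF _ L'(1)] integral_le_const
          integrable_const_bound[of _ "dist v w"]) auto
    finally have mean_diff_le:
      "\<bar>lagrangian_mean p (pullback v) - lagrangian_mean p (pullback w)\<bar> \<le> L' * dist v w" .
    show "dist (velocity v) (velocity w) \<le> (L + L') * dist v w"
    proof (rule dist_bound)
      fix x
      have "apply_bcontfun v x \<in> {- B..B}" "apply_bcontfun w x \<in> {- B..B}"
        using vw norm_bounded[of v x] norm_bounded[of w x] by auto
      from lipschitz_onD[OF bspec[OF L clamp_R] this, of x]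
      have "\<bar>p (clamp 0 R x * exp (- apply_bcontfun v x))
          - p (clamp 0 R x * exp (- apply_bcontfun w x))\<bar>
          \<le> L * \<bar>apply_bcontfun v x - apply_bcontfun w x\<bar>"
        by (simp add: dist_real_def)
      also have "\<dots> \<le> L * dist v w" using diff_le L_nonneg by (intro mult_left_mono)
      finally show "dist (apply_bcontfun (velocity v) x) (apply_bcontfun (velocity w) x)
          \<le> (L + L') * dist v w"
        using mean_diff_le by (simp add: apply_velocity dist_real_def distrib_right)
    qed
  qed (use L_nonneg L'(1) in simp)
  then show ?thesis by blast
qed

lemma velocity_solution_apply:
  assumes "(v has_vector_derivative velocity (v t)) (at t within S)"
  shows "((\<lambda>t. apply_bcontfun (v t) x) has_real_derivative
    p (clamp 0 R x * exp (- apply_bcontfun (v t) x)) - lagrangian_mean p (pullback (v t)))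
    (at t within S)"
proof -
  have "bounded_linear (\<lambda>f. apply_bcontfun f x)" for x :: real
    by (rule bounded_linear_intro[where K=1]) (auto simp: norm_bounded)
  from bounded_linear.has_vector_derivative[OF this assms, of x] show ?thesis
    by (simp add: has_real_derivative_iff_has_vector_derivative apply_velocity)
qed

lemma flow_on_velocity_solution:
  assumes T: "0 \<le> T" and v0: "v 0 = 0"
    and v: "\<And>t. t \<in> {0..T} \<Longrightarrow> (v has_vector_derivative velocity (v t)) (at t within {0..T})"
  shows "flow_on T (\<lambda>t. pullback (v (clamp 0 T t)))"
  unfolding flow_on_def
proof (intro conjI)
  have v_cont: "continuous_on {0..T} v" using v by (rule continuous_on_vector_derivative)
  have "continuous_on UNIV (\<lambda>z :: real \<times> real. (v (clamp 0 T (fst z)), snd z))"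
    using v_cont
    by (intro continuous_intros continuous_on_compose2[OF clamp_continuous_on[of 0 T v UNIV]])
      auto
  then have "continuous_on UNIV (\<lambda>z :: real \<times> real. apply_bcontfun (v (clamp 0 T (fst z))) (snd z))"
    using continuous_on_compose2[OF continuous_on_apply_bcontfun_prod] by fastforce
  then have [measurable]: "(\<lambda>z. apply_bcontfun (v (clamp 0 T (fst z))) (snd z))
      \<in> borel_measurable (borel \<Otimes>\<^sub>M borel)"
    unfolding borel_prod by (rule borel_measurable_continuous_onI)
  have "(\<lambda>z. (fst z, \<rho> (snd z))) \<in> borel \<Otimes>\<^sub>M M \<rightarrow>\<^sub>M borel \<Otimes>\<^sub>M (borel :: real measure)" by measurable
  from measurable_compose[OF this, of "\<lambda>z. apply_bcontfun (v (clamp 0 T (fst z))) (snd z)" borel]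
  show "(\<lambda>(t, y). pullback (v (clamp 0 T t)) y) \<in> borel_measurable (borel \<Otimes>\<^sub>M M)"
    by (simp add: case_prod_beta)
  have "bounded (v ` {0..T})" using v_cont by (intro compact_imp_bounded compact_continuous_image) auto
  then obtain B where "\<And>t. t \<in> {0..T} \<Longrightarrow> norm (v t) \<le> B" by (metis bounded_pos imageI)
  then have "\<bar>apply_bcontfun (v t) x\<bar> \<le> B" if "t \<in> {0..T}" for t x
    using order_trans[OF norm_bounded[of "v t" x]] that by simp
  then show "\<exists>B. \<forall>t\<in>{0..T}. \<forall>y. \<bar>pullback (v (clamp 0 T t)) y\<bar> \<le> B"
    using clamp_in_interval[of 0 T] by (intro exI[of _ B]) auto
  have clamp: "clamp 0 T t = t" if "t \<in> {0..T}" for t using that by simp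
  show "AE y in M. pullback (v (clamp 0 T 0)) y = 0 \<and>
    (\<forall>t\<in>{0..T}. ((\<lambda>t. pullback (v (clamp 0 T t)) y) has_real_derivative
      relative_pressure (pullback (v (clamp 0 T t))) y) (at t within {0..T}))"
  proof (intro AE_I2 conjI ballI)
    show "pullback (v (clamp 0 T 0)) y = 0" for y
      using T v0 by simp
    fix t y assume t: "t \<in> {0..T}"
    have "((\<lambda>t. pullback (v t) y) has_real_derivative
      relative_pressure (pullback (v t)) y) (at t within {0..T})"
      using velocity_solution_apply[OF v[OF t], of "\<rho> y"] \<rho>_range[of y]
      by (simp add: relative_pressure_def lagrangian_density_def)
    then show "((\<lambda>t. pullback (v (clamp 0 T t)) y) has_real_derivative
      relative_pressure (pullback (v (clamp 0 T t))) y) (at t within {0..T})"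
      unfolding clamp[OF t]
      by (rule has_field_derivative_transform_within[OF _ zero_less_one t]) simp
  qed
qed

end

context coercive_lagrangian_system
begin

lemma velocity_solution_bounded:
  assumes r: "is_barrier r" and S: "\<And>x. x \<in> {0..r} \<Longrightarrow> \<bar>p x\<bar> \<le> S"
    and t: "0 \<le> t" and v0: "v 0 = 0"
    and v: "\<And>s. s \<in> {0..t} \<Longrightarrow> (v has_vector_derivative velocity (v s)) (at s within {0..t})"
  shows "norm (v t) \<le> (S + (C + \<bar>C * initial_energy\<bar>)) * t"
proof (rule norm_bound)
  fix x
  define m where "m s = lagrangian_mean p (pullback (v s))" for s
  have mean_bounds: "- C \<le> m s" "m s \<le> C * initial_energy" if "s \<in> {0..t}" for s
    using flow_mean_pressure_bounds[OF flow_on_velocity_solution[OF t v0 v], of s] that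
    by (auto simp: m_def)
  define a where "a = clamp 0 R x"
  have a_range: "a \<in> {0..R}" unfolding a_def by (rule clamp_R)
  have deriv: "((\<lambda>s. apply_bcontfun (v s) x) has_real_derivative
    p (a * exp (- apply_bcontfun (v s) x)) - m s) (at s within {0..t})" if "s \<in> {0..t}" for s
    unfolding a_def m_def by (rule velocity_solution_apply[OF v[OF that]])
  have barrier: "a * exp (- apply_bcontfun (v s) x) \<le> r" if s: "s \<in> {0..t}" for s
  proof (rule exp_trajectory_le_barrier[where z="\<lambda>s. apply_bcontfun (v s) x" and p=p and m=m,
        OF deriv _ _ _ s])
    show "m s < p r" if "s \<in> {0..t}" for s using mean_bounds(2)[OF that] r by (simp add: is_barrier_def)
  qed (use a_range r v0 in \<open>auto simp: is_barrier_def\<close>)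
  have "norm (apply_bcontfun (v t) x - apply_bcontfun (v 0) x)
      \<le> (S + (C + \<bar>C * initial_energy\<bar>)) * norm (t - 0)"
  proof (rule field_differentiable_bound[OF _ deriv])
    fix s assume s: "s \<in> {0..t}"
    have "\<bar>p (a * exp (- apply_bcontfun (v s) x))\<bar> \<le> S" using a_range barrier[OF s] by (intro S) auto
    then show "norm (p (a * exp (- apply_bcontfun (v s) x)) - m s) \<le> S + (C + \<bar>C * initial_energy\<bar>)"
      using mean_bounds[OF s] C_pos unfolding real_norm_def by linarith
  qed (use t in auto)
  then show "norm (apply_bcontfun (v t) x) \<le> (S + (C + \<bar>C * initial_energy\<bar>)) * t"
    using t v0 by simp
qed

theorem flow_exists:
  assumes T: "0 \<le> T"
  obtains u where "flow_on T u"
proof -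
  obtain r where r: "is_barrier r" using barrier_exists by blast
  obtain S where S: "0 < S" "\<And>x. x \<in> {0..r} \<Longrightarrow> \<bar>p x\<bar> \<le> S"
    using continuous_on_atLeast_bounded_on_Icc[OF p_cont] by metis
  define b where "b = (S + (C + \<bar>C * initial_energy\<bar>)) * T"
  obtain L where L: "L-lipschitz_on (cball 0 (b + 1)) velocity" using velocity_lipschitz by blast
  have slope_nonneg: "0 \<le> S + (C + \<bar>C * initial_energy\<bar>)" using S(1) C_pos by simp
  obtain v where "v 0 = 0"
    "\<And>t. t \<in> {0..T} \<Longrightarrow> (v has_vector_derivative velocity (v t)) (at t within {0..T})"
  proof (rule ode_solution_if_a_priori_bound[OF L T, of 0 b])
    show "norm (0 :: real \<Rightarrow>\<^sub>C real) \<le> b" using slope_nonneg T by (simp add: b_def)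
    fix v t assume t: "t \<in> {0..T}" and v: "v 0 = 0"
      "\<And>s. s \<in> {0..t} \<Longrightarrow> (v has_vector_derivative velocity (v s)) (at s within {0..t})"
    have "norm (v t) \<le> (S + (C + \<bar>C * initial_energy\<bar>)) * t"
      using t by (intro velocity_solution_bounded[OF r S(2) _ v]) auto
    also have "\<dots> \<le> b" unfolding b_def using t slope_nonneg by (intro mult_left_mono) auto
    finally show "norm (v t) \<le> b" .
  qed auto
  from that[OF flow_on_velocity_solution[OF T this]] show thesis .
qed

end

section \<open>Flows and integral equations\<close>

context lagrangian_system
begin

lemma flow_set_integrals:
  assumes flow: "flow_on T u"
  shows "AE y in M. \<forall>t\<in>{0..T}. (LINT s:{0..t}|lebesgue. relative_pressure (u s) y) = u t y \<and>
    (LINT s:{0..t}|lebesgue. lagrangian_density (u s) y * relative_pressure (u s) y)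
      = \<rho> y - lagrangian_density (u t) y"
  using flow_derivative[OF flow]
proof eventually_elim
  case (elim y)
  obtain A K where bounds: "\<forall>t\<in>{0..T}. \<forall>y.
      \<bar>lagrangian_density (u t) y\<bar> \<le> A \<and> \<bar>relative_pressure (u t) y\<bar> \<le> K"
    using flow_density_and_pressure_bounded[OF flow] by blast
  show ?case
  proof (intro ballI conjI)
    fix t assume t: "t \<in> {0..T}"
    have deriv: "((\<lambda>t. u t y) has_real_derivative relative_pressure (u s) y) (at s within {0..t})"
      if s: "s \<in> {0..t}" for s
    proof (rule DERIV_subset)
      show "((\<lambda>t. u t y) has_real_derivative relative_pressure (u s) y) (at s within {0..T})"
        using elim s t by simp
    qed (use t in auto)
    have "(LINT s:{0..t}|lebesgue. relative_pressure (u s) y) = u t y - u 0 y"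
      by (rule set_integral_derivative[where B=K, OF _ deriv]) (use t bounds in auto)
    then show "(LINT s:{0..t}|lebesgue. relative_pressure (u s) y) = u t y" using elim by simp
    have "(LINT s:{0..t}|lebesgue. lagrangian_density (u s) y * relative_pressure (u s) y)
        = - lagrangian_density (u t) y - - lagrangian_density (u 0) y"
    proof (rule set_integral_derivative)
      fix s assume s: "s \<in> {0..t}"
      show "((\<lambda>t. - lagrangian_density (u t) y) has_real_derivative
          lagrangian_density (u s) y * relative_pressure (u s) y) (at s within {0..t})"
        unfolding lagrangian_density_def by (auto intro!: derivative_eq_intros deriv[OF s])
      show "\<bar>lagrangian_density (u s) y * relative_pressure (u s) y\<bar> \<le> A * K"
        unfolding abs_mult using bounds s t by (intro mult_mono') auto
    qed (use t in auto)
    then show "(LINT s:{0..t}|lebesgue. lagrangian_density (u s) y * relative_pressure (u s) y)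
        = \<rho> y - lagrangian_density (u t) y"
      using elim by (simp add: lagrangian_density_def)
  qed
qed

lemma relative_pressure_continuous_on:
  assumes bounded: "\<And>t. t \<in> {0..T} \<Longrightarrow> u t \<in> bounded_measurable M B"
    and lipschitz: "\<And>s t y. s \<in> {0..T} \<Longrightarrow> t \<in> {0..T} \<Longrightarrow> \<bar>u t y - u s y\<bar> \<le> K * \<bar>t - s\<bar>"
  shows "continuous_on {0..T} (\<lambda>t. relative_pressure (u t) y)"
proof -
  obtain L where L: "0 \<le> L" "\<forall>w\<in>bounded_measurable M B. \<forall>w'\<in>bounded_measurable M B. \<forall>y.
      \<bar>relative_pressure w y - relative_pressure w' y\<bar>
        \<le> L * (\<bar>w y - w' y\<bar> + expectation (\<lambda>y. \<bar>w y - w' y\<bar>))"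
    using relative_pressure_lipschitz by blast
  have "\<bar>relative_pressure (u t) y - relative_pressure (u s) y\<bar> \<le> L * (2 * \<bar>K\<bar>) * \<bar>t - s\<bar>"
    if st: "s \<in> {0..T}" "t \<in> {0..T}" for s t
  proof -
    have diff_le: "\<bar>u t y - u s y\<bar> \<le> \<bar>K\<bar> * \<bar>t - s\<bar>" for y
      by (rule order_trans[OF lipschitz[OF st] mult_right_mono]) auto
    have "integrable M (\<lambda>y. u t y - u s y)"
      by (rule integrable_bounded_measurable[OF bounded_measurable_diff[OF bounded bounded]])
         (use st in auto)
    then have "expectation (\<lambda>y. \<bar>u t y - u s y\<bar>) \<le> \<bar>K\<bar> * \<bar>t - s\<bar>"
      using diff_le by (intro integral_le_const) auto
    then have "\<bar>u t y - u s y\<bar> + expectation (\<lambda>y. \<bar>u t y - u s y\<bar>) \<le> 2 * \<bar>K\<bar> * \<bar>t - s\<bar>"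
      using diff_le[of y] by linarith
    then have "L * (\<bar>u t y - u s y\<bar> + expectation (\<lambda>y. \<bar>u t y - u s y\<bar>)) \<le> L * (2 * \<bar>K\<bar> * \<bar>t - s\<bar>)"
      using L(1) by (rule mult_left_mono)
    then show ?thesis
      using bspec[OF bspec[OF L(2) bounded[OF st(2)]] bounded[OF st(1)], rule_format, of y]
      by (simp add: mult.assoc)
  qed
  then have "(L * (2 * \<bar>K\<bar>))-lipschitz_on {0..T} (\<lambda>t. relative_pressure (u t) y)"
    using L(1) by (intro lipschitz_onI) (auto simp: dist_real_def)
  then show ?thesis by (rule lipschitz_on_continuous_on)
qed

lemma flow_on_if_integral_equation:
  assumes meas: "(\<lambda>(t, y). u t y) \<in> borel_measurable (borel \<Otimes>\<^sub>M M)"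
    and lipschitz: "\<And>s t y. s \<in> {0..T} \<Longrightarrow> t \<in> {0..T} \<Longrightarrow> \<bar>u t y - u s y\<bar> \<le> K * \<bar>t - s\<bar>"
    and u0: "\<And>y. u 0 y = 0"
    and u_eq: "AE y in M. \<forall>t\<in>{0..T}. u t y = integral {0..t} (\<lambda>s. relative_pressure (u s) y)"
  shows "flow_on T u"
proof -
  have abs_le: "\<bar>u t y\<bar> \<le> \<bar>K\<bar> * T" if "t \<in> {0..T}" for t y
  proof -
    have "\<bar>u t y\<bar> \<le> K * t" using lipschitz[of 0 t y] u0 that by simp
    also have "\<dots> \<le> \<bar>K\<bar> * T" using that by (intro mult_mono) auto
    finally show ?thesis .
  qed
  have "u t \<in> bounded_measurable M (\<bar>K\<bar> * T)" if "t \<in> {0..T}" for t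
    using abs_le[OF that] measurable_Pair2[OF meas, of t] by (simp add: bounded_measurable_def)
  note pressure_cont = relative_pressure_continuous_on[OF this lipschitz]
  have "AE y in M. u 0 y = 0 \<and>
    (\<forall>t\<in>{0..T}. ((\<lambda>t. u t y) has_real_derivative relative_pressure (u t) y) (at t within {0..T}))"
    using u_eq
  proof eventually_elim
    case (elim y)
    have "((\<lambda>t. u t y) has_real_derivative relative_pressure (u t) y) (at t within {0..T})"
      if t: "t \<in> {0..T}" for t
      by (rule has_field_derivative_transform_within
            [OF integral_has_real_derivative[OF pressure_cont t] zero_less_one t])
         (use elim in auto)
    then show ?case using u0 by blast
  qed
  then show ?thesis unfolding flow_on_def using meas abs_le by blast
qed

lemma borel_measurable_flow:
  assumes flow: "flow_on T u"
  shows "(\<lambda>z. lagrangian_density (u (fst z)) (snd z)) \<in> borel_measurable (borel \<Otimes>\<^sub>M M)"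
    and "(\<lambda>z. relative_pressure (u (fst z)) (snd z)) \<in> borel_measurable (borel \<Otimes>\<^sub>M M)"
proof -
  have u [measurable]: "(\<lambda>z. u (fst z) (snd z)) \<in> borel_measurable (borel \<Otimes>\<^sub>M M)"
    using flow by (simp add: flow_on_def case_prod_beta')
  show density: "(\<lambda>z. lagrangian_density (u (fst z)) (snd z)) \<in> borel_measurable (borel \<Otimes>\<^sub>M M)"
    unfolding lagrangian_density_def by measurable
  have [measurable]: "(\<lambda>z. p (lagrangian_density (u (fst z)) (snd z))) \<in> borel_measurable (borel \<Otimes>\<^sub>M M)"
    by (intro borel_measurable_comp_continuous_on_nonneg[OF p_cont density] lagrangian_density_nonneg)
  have [measurable]: "(\<lambda>t. lagrangian_mean p (u t)) \<in> borel_measurable borel"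
    unfolding lagrangian_mean_def
    by (rule borel_measurable_lebesgue_integral) (simp add: case_prod_beta')
  show "(\<lambda>z. relative_pressure (u (fst z)) (snd z)) \<in> borel_measurable (borel \<Otimes>\<^sub>M M)"
    unfolding relative_pressure_def by measurable
qed

end

section \<open>Essentially bounded functions on the torus\<close>

lemma Linfty_on_borel_representative:
  assumes "Linfty_on S f"
  obtains g B where "g \<in> borel_measurable borel" "\<And>x. \<bar>g x\<bar> \<le> B" "AE x in lborel. x \<in> S \<longrightarrow> f x = g x"
proof -
  obtain B where B: "AE x in lebesgue. x \<in> S \<longrightarrow> \<bar>f x\<bar> \<le> B"
    and f_meas: "(\<lambda>x. indicator S x *\<^sub>R f x) \<in> borel_measurable lebesgue"
    using assms unfolding Linfty_on_def set_borel_measurable_def by auto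
  obtain g where g: "g \<in> borel_measurable lborel" "AE x in lborel. indicator S x *\<^sub>R f x = g x"
    using completion_ex_borel_measurable_real[OF f_meas] by auto
  define h where "h x = max (- \<bar>B\<bar>) (min \<bar>B\<bar> (g x))" for x
  show ?thesis
  proof (rule that[of h "\<bar>B\<bar>"])
    show "h \<in> borel_measurable borel" using g(1) unfolding h_def by simp
    show "\<bar>h x\<bar> \<le> \<bar>B\<bar>" for x by (auto simp: h_def)
    show "AE x in lborel. x \<in> S \<longrightarrow> f x = h x"
      using g(2) B[unfolded AE_completion_iff]
      by eventually_elim (auto simp: h_def)
  qed
qed

lemma Linfty_on_Times_borel_representative:
  assumes "Linfty_on (A \<times> B) (\<lambda>(t, y). f t y)"
  obtains g K where "g \<in> borel_measurable borel" "\<And>z. \<bar>g z\<bar> \<le> K"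
    "AE z in lborel. z \<in> A \<times> B \<longrightarrow> f (fst z) (snd z) = g (fst z, snd z)"
  by (rule Linfty_on_borel_representative[OF assms]) (auto intro: that simp: case_prod_beta)

lemma Linfty_on_if_borel:
  assumes "f \<in> borel_measurable borel" "S \<in> sets borel" "\<And>x. x \<in> S \<Longrightarrow> \<bar>f x\<bar> \<le> B"
  shows "Linfty_on S f"
  unfolding Linfty_on_def set_borel_measurable_def
proof
  show "(\<lambda>x. indicator S x *\<^sub>R f x) \<in> borel_measurable lebesgue"
    using assms(1,2) by (intro measurable_completion) simp
  show "\<exists>B. AE x in lebesgue. x \<in> S \<longrightarrow> \<bar>f x\<bar> \<le> B" using assms(3) by (intro exI[of _ B]) auto
qed

lemma torus_borel [measurable]: "(torus :: (real^'d) set) \<in> sets borel"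
  by (simp add: torus_def)

lemma emeasure_torus: "emeasure lborel (torus :: (real^'d) set) = 1"
  unfolding torus_def by (subst emeasure_lborel_cbox) (auto simp: inner_sum_left_Basis)

abbreviation torus_measure :: "(real^'d) measure" where
  "torus_measure \<equiv> uniform_measure lborel torus"

lemma prob_space_torus_measure: "prob_space (torus_measure :: (real^'d) measure)"
  by (rule prob_space_uniform_measure) (simp_all add: emeasure_torus)

lemma AE_torus_measure_iff:
  "(AE y in (torus_measure :: (real^'d) measure). Q y) \<longleftrightarrow> (AE y in lborel. y \<in> torus \<longrightarrow> Q y)"
  by (rule AE_uniform_measure) (simp_all add: emeasure_torus)

lemma set_integral_torus:
  fixes f g :: "real^'d \<Rightarrow> real"
  assumes g: "g \<in> borel_measurable borel" and f_eq_g: "AE y in torus_measure. f y = g y"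
  shows "(LINT y:torus|lebesgue. f y) = (\<integral>y. g y \<partial>torus_measure)"
proof -
  have "(LINT y:torus|lebesgue. f y) = (LINT y:torus|lborel. g y)"
    using g f_eq_g by (intro set_lebesgue_integral_lebesgue_cong_AE) (auto simp: AE_torus_measure_iff)
  also have "\<dots> = (\<integral>y. g y \<partial>density lborel (\<lambda>y. ennreal (indicator torus y)))"
    unfolding set_lebesgue_integral_def using g by (subst integral_density) auto
  also have "\<dots> = (\<integral>y. g y \<partial>torus_measure)"
    by (simp add: uniform_measure_def emeasure_torus ennreal_indicator divide_ennreal_def)
  finally show ?thesis .
qed

lemma sets_borel_pair_torus_measure:
  "sets ((borel :: real measure) \<Otimes>\<^sub>M (torus_measure :: (real^'d) measure)) = sets borel"
  unfolding borel_prod[symmetric] by (intro sets_pair_measure_cong) auto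

lemma AE_Times_torusI:
  fixes Q :: "real \<Rightarrow> real^'d \<Rightarrow> bool"
  assumes "AE y in torus_measure. \<forall>t\<in>I. Q t y"
  shows "AE z in lborel. z \<in> I \<times> torus \<longrightarrow> Q (fst z) (snd z)"
proof -
  have "AE z in lborel \<Otimes>\<^sub>M lborel. snd z \<in> torus \<longrightarrow> (\<forall>t\<in>I. Q t (snd z))"
    using assms unfolding AE_torus_measure_iff by (rule lborel_pair.AE_pair_snd)
  then show ?thesis unfolding lborel_prod by eventually_elim auto
qed

lemma
  fixes Q :: "real \<Rightarrow> real^'d \<Rightarrow> bool"
  assumes Q: "{z. Q (fst z) (snd z)} \<in> sets borel" and I [measurable]: "I \<in> sets borel"
  shows AE_Times_torus_if_AE_AE: "AE y in torus_measure. AE t in lborel. t \<in> I \<longrightarrow> Q t y \<Longrightarrow>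
      AE z in lborel. z \<in> I \<times> torus \<longrightarrow> Q (fst z) (snd z)"
    and AE_Times_torus_if_all_AE: "(\<And>t. t \<in> I \<Longrightarrow> AE y in torus_measure. Q t y) \<Longrightarrow>
      AE z in lborel. z \<in> I \<times> torus \<longrightarrow> Q (fst z) (snd z)"
proof -
  let ?P = "\<lambda>t y. (t, y) \<in> I \<times> torus \<longrightarrow> Q t y"
  have [measurable]: "Measurable.pred (borel \<Otimes>\<^sub>M borel) (\<lambda>z :: real \<times> (real^'d). Q (fst z) (snd z))"
    unfolding borel_prod pred_def using Q by simp
  have meas: "{z \<in> space (lborel \<Otimes>\<^sub>M lborel). ?P (fst z) (snd z)} \<in> sets (lborel \<Otimes>\<^sub>M lborel)"
    by measurable
  have AE_if_sections: "AE z in lborel. z \<in> I \<times> torus \<longrightarrow> Q (fst z) (snd z)"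
    if "AE t in lborel. AE y in lborel. ?P t y"
    using that unfolding lborel_pair.AE_pair_iff[OF meas] lborel_prod by simp
  show "AE z in lborel. z \<in> I \<times> torus \<longrightarrow> Q (fst z) (snd z)"
    if "AE y in torus_measure. AE t in lborel. t \<in> I \<longrightarrow> Q t y"
  proof (rule AE_if_sections)
    have "AE y in lborel. AE t in lborel. ?P t y"
      using that unfolding AE_torus_measure_iff by eventually_elim (auto elim!: eventually_mono)
    then show "AE t in lborel. AE y in lborel. ?P t y"
      using lborel_pair.AE_commute[OF meas] by blast
  qed
  show "AE z in lborel. z \<in> I \<times> torus \<longrightarrow> Q (fst z) (snd z)"
    if "\<And>t. t \<in> I \<Longrightarrow> AE y in torus_measure. Q t y"
  proof (rule AE_if_sections, rule AE_I2)
    show "AE y in lborel. ?P t y" for t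
      using that[of t] unfolding AE_torus_measure_iff by (cases "t \<in> I") (auto elim!: eventually_mono)
  qed
qed

lemma
  fixes Q :: "real \<Rightarrow> real^'d \<Rightarrow> bool"
  assumes "AE z in lborel. z \<in> I \<times> torus \<longrightarrow> Q (fst z) (snd z)"
  shows AE_Times_torusD1: "AE t in lborel. t \<in> I \<longrightarrow> (AE y in torus_measure. Q t y)"
    and AE_Times_torusD2: "AE y in torus_measure. AE t in lborel. t \<in> I \<longrightarrow> Q t y"
proof -
  note AE_prod = assms[folded lborel_prod]
  show "AE t in lborel. t \<in> I \<longrightarrow> (AE y in torus_measure. Q t y)"
    using lborel_pair.AE_pair[OF AE_prod] unfolding AE_torus_measure_iff
    by eventually_elim (auto elim!: eventually_mono)
  show "AE y in torus_measure. AE t in lborel. t \<in> I \<longrightarrow> Q t y"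
    using lborel_pair.AE_pair_swap[OF AE_prod] unfolding AE_torus_measure_iff
    by eventually_elim (auto elim!: eventually_mono)
qed

section \<open>Solutions of the Lagrangian system\<close>

lemma
  fixes g :: "real \<times> 'b::euclidean_space \<Rightarrow> real"
  assumes g [measurable]: "g \<in> borel_measurable borel" and g_le: "\<And>z. \<bar>g z\<bar> \<le> B"
  shows borel_measurable_primitive: "(\<lambda>(t, y). integral {0..t} (\<lambda>s. g (s, y))) \<in> borel_measurable borel"
    and has_integral_primitive: "((\<lambda>s. g (s, y)) has_integral integral {a..b} (\<lambda>s. g (s, y))) {a..b}"
    and primitive_lipschitz: "s \<in> {0..T} \<Longrightarrow> t \<in> {0..T} \<Longrightarrow>
      \<bar>integral {0..t} (\<lambda>s. g (s, y)) - integral {0..s} (\<lambda>s. g (s, y))\<bar> \<le> B * \<bar>t - s\<bar>"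
proof -
  have g_prod: "g \<in> borel_measurable (borel \<Otimes>\<^sub>M borel)"
    by (simp add: borel_prod)
  have section_meas: "(\<lambda>s. g (s, y)) \<in> borel_measurable borel" for y
    using measurable_Pair1[OF g_prod, of y] by simp
  note section_integral = has_integral_bounded_borel[OF section_meas g_le]
  show has_int: "((\<lambda>s. g (s, y)) has_integral integral {a..b} (\<lambda>s. g (s, y))) {a..b}" for y a b
    using section_integral[of y a b] by (simp add: has_integral_iff)
  show "(\<lambda>(t, y). integral {0..t} (\<lambda>s. g (s, y))) \<in> borel_measurable borel"
    using borel_measurable_set_integral_atLeastAtMost[OF g_prod, of 0]
    by (simp add: borel_prod integral_unique[OF section_integral])
  have increment: "\<bar>integral {0..t} (\<lambda>s. g (s, y)) - integral {0..s} (\<lambda>s. g (s, y))\<bar> \<le> B * (t - s)"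
    if "0 \<le> s" "s \<le> t" for s t
    using that has_int[of y 0 t] has_int[of y s t] g_le norm_integral_le[of "\<lambda>s. g (s, y)" s t B]
    by (simp add: indefinite_integral_increment[of _ 0 t] has_integral_integrable)
  show "\<bar>integral {0..t} (\<lambda>s. g (s, y)) - integral {0..s} (\<lambda>s. g (s, y))\<bar> \<le> B * \<bar>t - s\<bar>"
    if "s \<in> {0..T}" "t \<in> {0..T}"
    using increment[of s t] increment[of t s] that by (cases "s \<le> t") (auto simp: abs_minus_commute)
qed

lemma AE_set_integral_eq_primitive:
  fixes g :: "real \<times> (real^'d) \<Rightarrow> real"
  assumes g: "g \<in> borel_measurable borel" "\<And>z. \<bar>g z\<bar> \<le> B"
    and \<sigma>_g: "AE z in lborel. z \<in> {0..T} \<times> torus \<longrightarrow> \<sigma> (fst z) (snd z) = g (fst z, snd z)"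
  shows "AE y in torus_measure. \<forall>t\<in>{0..T}.
    (LINT s:{0..t}|lebesgue. \<sigma> s y) = integral {0..t} (\<lambda>s. g (s, y))"
  using AE_Times_torusD2[OF \<sigma>_g]
proof eventually_elim
  case (elim y)
  show ?case
  proof
    fix t assume t: "t \<in> {0..T}"
    have meas: "(\<lambda>s. g (s, y)) \<in> borel_measurable borel"
      using measurable_Pair1[of g borel borel borel y] g(1) by (simp add: borel_prod)
    have "AE s in lborel. s \<in> {0..t} \<longrightarrow> \<sigma> s y = g (s, y)"
      using elim by eventually_elim (use t in auto)
    then have "(LINT s:{0..t}|lebesgue. \<sigma> s y) = (LINT s:{0..t}|lborel. g (s, y))"
      by (intro set_lebesgue_integral_lebesgue_cong_AE meas) auto
    then show "(LINT s:{0..t}|lebesgue. \<sigma> s y) = integral {0..t} (\<lambda>s. g (s, y))"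
      by (simp add: integral_unique[OF has_integral_bounded_borel[OF meas g(2)]])
  qed
qed

locale torus_lagrangian_system = lagrangian_system torus_measure p \<rho> R
  for p and \<rho> :: "real^'d \<Rightarrow> real" and R +
  fixes rho0 :: "real^'d \<Rightarrow> real"
  assumes rho0_eq: "AE y in torus_measure. rho0 y = \<rho> y"
begin

definition represents :: "real \<Rightarrow> (real \<Rightarrow> real^'d \<Rightarrow> real) \<Rightarrow> (real \<Rightarrow> real^'d \<Rightarrow> real) \<Rightarrow>
    (real \<Rightarrow> real^'d \<Rightarrow> real) \<Rightarrow> bool" where
  "represents T u \<eta> \<sigma> \<longleftrightarrow> flow_on T u \<and>
    (AE z in lborel. z \<in> {0..T} \<times> torus \<longrightarrow> \<eta> (fst z) (snd z) = lagrangian_density (u (fst z)) (snd z) \<and>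
      \<sigma> (fst z) (snd z) = relative_pressure (u (fst z)) (snd z))"

lemma avg_sigma_eq_lagrangian_mean:
  assumes w: "w \<in> borel_measurable torus_measure"
    and f_eq: "AE y in torus_measure.
      f t y = lagrangian_density w y \<and> (LINT s:{0..t}|lebesgue. \<sigma> s y) = w y"
  shows "avg_sigma \<sigma> (\<lambda>t y. p (f t y)) t = lagrangian_mean p w"
proof -
  have "(LINT y:torus|lebesgue. p (f t y) * exp (LINT s:{0..t}|lebesgue. \<sigma> s y))
      = (\<integral>y. p (lagrangian_density w y) * exp (w y) \<partial>torus_measure)"
  proof (rule set_integral_torus)
    show "(\<lambda>y. p (lagrangian_density w y) * exp (w y)) \<in> borel_measurable borel"
      using w borel_measurable_comp_lagrangian_density[OF p_cont w] by measurable
    show "AE y in torus_measure. p (f t y) * exp (LINT s:{0..t}|lebesgue. \<sigma> s y)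
        = p (lagrangian_density w y) * exp (w y)"
      using f_eq by eventually_elim simp
  qed
  moreover have "measure lebesgue (torus :: (real^'d) set) = 1"
    by (simp add: measure_def emeasure_torus)
  ultimately show ?thesis by (simp add: avg_sigma_def lagrangian_mean_def)
qed

theorem solves_L_if_flow:
  assumes flow: "flow_on T u"
  shows "solves_L p rho0 T (\<lambda>t. lagrangian_density (u t)) (\<lambda>t. relative_pressure (u t))"
  unfolding solves_L_def AE_completion_iff
proof (intro conjI)
  obtain A K where bounds: "\<forall>t\<in>{0..T}. \<forall>y.
      \<bar>lagrangian_density (u t) y\<bar> \<le> A \<and> \<bar>relative_pressure (u t) y\<bar> \<le> K"
    using flow_density_and_pressure_bounded[OF flow] by blast
  have domain: "{0..T} \<times> torus \<in> sets (borel :: (real \<times> (real^'d)) measure)"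
    unfolding borel_prod[symmetric] by measurable
  note flow_meas = borel_measurable_flow[OF flow,
      unfolded measurable_cong_sets[OF sets_borel_pair_torus_measure refl]]
  show "Linfty_on ({0..T} \<times> torus) (\<lambda>(t, y). lagrangian_density (u t) y)"
    unfolding case_prod_beta by (rule Linfty_on_if_borel[OF flow_meas(1) domain]) (use bounds in auto)
  show "Linfty_on ({0..T} \<times> torus) (\<lambda>(t, y). relative_pressure (u t) y)"
    unfolding case_prod_beta by (rule Linfty_on_if_borel[OF flow_meas(2) domain]) (use bounds in auto)
  note integrals = flow_set_integrals[OF flow]
  have avg_eq: "avg_sigma (\<lambda>t. relative_pressure (u t)) (\<lambda>t y. p (lagrangian_density (u t) y)) t
      = lagrangian_mean p (u t)"
    if t: "t \<in> {0..T}" for t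
    by (rule avg_sigma_eq_lagrangian_mean[OF flow_measurable[OF flow]])
       (use integrals in eventually_elim, use t in auto)
  have "AE y in torus_measure. \<forall>t\<in>{0..T}.
      lagrangian_density (u t) y = rho0 y
        - (LINT s:{0..t}|lebesgue. lagrangian_density (u s) y * relative_pressure (u s) y) \<and>
      relative_pressure (u t) y = p (lagrangian_density (u t) y)
        - avg_sigma (\<lambda>t. relative_pressure (u t)) (\<lambda>t y. p (lagrangian_density (u t) y)) t"
    using integrals rho0_eq by eventually_elim (auto simp: relative_pressure_def avg_eq)
  then show "AE z in lborel. z \<in> {0..T} \<times> torus \<longrightarrow>
      lagrangian_density (u (fst z)) (snd z) = rho0 (snd z)
        - (LINT s:{0..fst z}|lebesgue. lagrangian_density (u s) (snd z) * relative_pressure (u s) (snd z)) \<and>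
      relative_pressure (u (fst z)) (snd z) = p (lagrangian_density (u (fst z)) (snd z))
        - avg_sigma (\<lambda>t. relative_pressure (u t)) (\<lambda>t y. p (lagrangian_density (u t) y)) (fst z)"
    by (rule AE_Times_torusI)
qed

lemma solves_L_density_eq:
  assumes sol: "solves_L p rho0 T \<eta> \<sigma>"
    and g: "g \<in> borel_measurable borel" "\<And>z. \<bar>g z\<bar> \<le> B"
    and \<sigma>_g: "AE z in lborel. z \<in> {0..T} \<times> torus \<longrightarrow> \<sigma> (fst z) (snd z) = g (fst z, snd z)"
  shows "AE z in lborel. z \<in> {0..T} \<times> torus \<longrightarrow>
    \<eta> (fst z) (snd z) = lagrangian_density (\<lambda>y. integral {0..fst z} (\<lambda>s. g (s, y))) (snd z)"
proof -
  have "Linfty_on ({0..T} \<times> torus) (\<lambda>(t, y). \<eta> t y)"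
    using sol by (simp add: solves_L_def)
  then obtain h A where h: "h \<in> borel_measurable borel" "\<And>z. \<bar>h z\<bar> \<le> A"
    and \<eta>_h: "AE z in lborel. z \<in> {0..T} \<times> torus \<longrightarrow> \<eta> (fst z) (snd z) = h (fst z, snd z)"
    by (rule Linfty_on_Times_borel_representative) blast
  have \<eta>_eq: "AE z in lborel. z \<in> {0..T} \<times> torus \<longrightarrow>
      \<eta> (fst z) (snd z) = rho0 (snd z) - (LINT s:{0..fst z}|lebesgue. \<eta> s (snd z) * \<sigma> s (snd z))"
    using sol unfolding solves_L_def AE_completion_iff by (auto elim!: eventually_mono)
  have section_meas: "(\<lambda>s. f (s, y)) \<in> borel_measurable borel" if "f \<in> borel_measurable borel"
    for f :: "real \<times> (real^'d) \<Rightarrow> real" and y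
    using measurable_Pair1[of f borel borel borel y] that by (simp add: borel_prod)
  have "AE y in torus_measure. AE t in lborel. t \<in> {0..T} \<longrightarrow>
      h (t, y) = \<rho> y * exp (- integral {0..t} (\<lambda>s. g (s, y)))"
    using rho0_eq AE_Times_torusD2[OF \<eta>_h] AE_Times_torusD2[OF \<sigma>_g] AE_Times_torusD2[OF \<eta>_eq]
  proof eventually_elim
    case (elim y)
    have "AE t in lborel. t \<in> {0..T} \<longrightarrow> \<eta> t y = rho0 y * exp (- integral {0..t} (\<lambda>s. g (s, y)))"
      by (rule AE_linear_integral_equation_exp
            [OF section_meas[OF h(1)] h(2) section_meas[OF g(1)] g(2) elim(2-4)])
    with elim(2) show ?case by eventually_elim (use elim(1) in auto)
  qed
  moreover have "{z. h (fst z, snd z) = \<rho> (snd z) * exp (- integral {0..fst z} (\<lambda>s. g (s, snd z)))}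
      \<in> sets borel"
  proof -
    have [measurable]: "(\<lambda>z. \<rho> (snd z)) \<in> borel_measurable (borel :: (real \<times> (real^'d)) measure)"
      using \<rho>_meas unfolding borel_prod[symmetric] by measurable
    note [measurable] = h(1) borel_measurable_primitive[OF g, unfolded case_prod_beta]
    have "{z \<in> space borel. h z = \<rho> (snd z) * exp (- integral {0..fst z} (\<lambda>s. g (s, snd z)))}
        \<in> sets borel"
      by measurable
    then show ?thesis by simp
  qed
  ultimately have "AE z in lborel. z \<in> {0..T} \<times> torus \<longrightarrow>
      h (fst z, snd z) = \<rho> (snd z) * exp (- integral {0..fst z} (\<lambda>s. g (s, snd z)))"
    by (intro AE_Times_torus_if_AE_AE) auto
  with \<eta>_h show ?thesis by eventually_elim (auto simp: lagrangian_density_def)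
qed

lemma solves_L_relative_pressure_eq:
  assumes sol: "solves_L p rho0 T \<eta> \<sigma>"
    and u: "\<And>t. u t \<in> borel_measurable torus_measure"
    and integral_\<sigma>: "AE y in torus_measure. \<forall>t\<in>{0..T}. (LINT s:{0..t}|lebesgue. \<sigma> s y) = u t y"
    and density: "AE z in lborel. z \<in> {0..T} \<times> torus \<longrightarrow>
      \<eta> (fst z) (snd z) = lagrangian_density (u (fst z)) (snd z)"
  shows "AE z in lborel. z \<in> {0..T} \<times> torus \<longrightarrow>
      \<sigma> (fst z) (snd z) = relative_pressure (u (fst z)) (snd z)"
proof -
  have "AE t in lborel. t \<in> {0..T} \<longrightarrow> avg_sigma \<sigma> (\<lambda>t y. p (\<eta> t y)) t = lagrangian_mean p (u t)"
    using AE_Times_torusD1[OF density]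
  proof eventually_elim
    case (elim t)
    show ?case
    proof
      assume t: "t \<in> {0..T}"
      show "avg_sigma \<sigma> (\<lambda>t y. p (\<eta> t y)) t = lagrangian_mean p (u t)"
      proof (rule avg_sigma_eq_lagrangian_mean[OF u])
        show "AE y in torus_measure.
            \<eta> t y = lagrangian_density (u t) y \<and> (LINT s:{0..t}|lebesgue. \<sigma> s y) = u t y"
          using elim[rule_format, OF t] integral_\<sigma> by eventually_elim (use t in auto)
      qed
    qed
  qed
  then have "AE z in lborel \<Otimes>\<^sub>M lborel. fst z \<in> {0..T} \<longrightarrow>
      avg_sigma \<sigma> (\<lambda>t y. p (\<eta> t y)) (fst z) = lagrangian_mean p (u (fst z))"
    by (rule lborel_pair.AE_pair_fst)
  moreover have "AE z in lborel. z \<in> {0..T} \<times> torus \<longrightarrow>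
      \<sigma> (fst z) (snd z) = p (\<eta> (fst z) (snd z)) - avg_sigma \<sigma> (\<lambda>t y. p (\<eta> t y)) (fst z)"
    using sol unfolding solves_L_def AE_completion_iff by (auto elim!: eventually_mono)
  ultimately show ?thesis
    using density unfolding lborel_prod by eventually_elim (auto simp: relative_pressure_def)
qed

theorem solves_L_imp_flow:
  assumes sol: "solves_L p rho0 T \<eta> \<sigma>"
  obtains u where "represents T u \<eta> \<sigma>"
proof -
  have "Linfty_on ({0..T} \<times> torus) (\<lambda>(t, y). \<sigma> t y)"
    using sol by (simp add: solves_L_def)
  then obtain g B where g: "g \<in> borel_measurable borel" "\<And>z. \<bar>g z\<bar> \<le> B"
    and \<sigma>_g: "AE z in lborel. z \<in> {0..T} \<times> torus \<longrightarrow> \<sigma> (fst z) (snd z) = g (fst z, snd z)"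
    by (rule Linfty_on_Times_borel_representative) blast
  define u where "u t y = integral {0..t} (\<lambda>s. g (s, y))" for t y
  have u_meas: "(\<lambda>(t, y). u t y) \<in> borel_measurable (borel \<Otimes>\<^sub>M torus_measure)"
    unfolding u_def measurable_cong_sets[OF sets_borel_pair_torus_measure refl]
    by (rule borel_measurable_primitive[OF g])
  have density: "AE z in lborel. z \<in> {0..T} \<times> torus \<longrightarrow>
      \<eta> (fst z) (snd z) = lagrangian_density (u (fst z)) (snd z)"
    using solves_L_density_eq[OF sol g \<sigma>_g] by (simp add: u_def[abs_def])
  have "AE y in torus_measure. \<forall>t\<in>{0..T}. (LINT s:{0..t}|lebesgue. \<sigma> s y) = u t y"
    unfolding u_def by (rule AE_set_integral_eq_primitive[OF g \<sigma>_g])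
  then have pressure: "AE z in lborel. z \<in> {0..T} \<times> torus \<longrightarrow>
      \<sigma> (fst z) (snd z) = relative_pressure (u (fst z)) (snd z)"
    using measurable_Pair2[OF u_meas] by (intro solves_L_relative_pressure_eq[OF sol _ _ density]) auto
  have "AE z in lborel. z \<in> {0..T} \<times> torus \<longrightarrow> g (fst z, snd z) = relative_pressure (u (fst z)) (snd z)"
    using pressure \<sigma>_g by eventually_elim auto
  from AE_Times_torusD2[OF this]
  have "AE y in torus_measure. \<forall>t\<in>{0..T}. u t y = integral {0..t} (\<lambda>s. relative_pressure (u s) y)"
  proof eventually_elim
    case (elim y)
    have "((\<lambda>s. relative_pressure (u s) y) has_integral u t y) {0..t}" if t: "t \<in> {0..T}" for t
      using has_integral_primitive[OF g, of y 0 t] unfolding u_def[symmetric]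
      by (rule has_integral_AE[THEN iffD1, rotated]) (use elim in eventually_elim, use t in auto)
    then show ?case by (auto intro!: integral_unique[symmetric])
  qed
  then have "flow_on T u"
  proof (rule flow_on_if_integral_equation[OF u_meas, rotated 2])
    show "\<bar>u t y - u s y\<bar> \<le> B * \<bar>t - s\<bar>" if "s \<in> {0..T}" "t \<in> {0..T}" for s t y
      unfolding u_def by (rule primitive_lipschitz[OF g that])
  qed (simp add: u_def)
  moreover have "AE z in lborel. z \<in> {0..T} \<times> torus \<longrightarrow>
      \<eta> (fst z) (snd z) = lagrangian_density (u (fst z)) (snd z) \<and>
      \<sigma> (fst z) (snd z) = relative_pressure (u (fst z)) (snd z)"
    using density pressure by eventually_elim simp
  ultimately show thesis by (intro that) (simp add: represents_def)
qed

theorem solves_L_unique: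
  assumes "solves_L p rho0 T \<eta> \<sigma>" "solves_L p rho0 T \<eta>' \<sigma>'"
  shows "AE z in lebesgue. z \<in> {0..T} \<times> torus \<longrightarrow>
    \<eta> (fst z) (snd z) = \<eta>' (fst z) (snd z) \<and> \<sigma> (fst z) (snd z) = \<sigma>' (fst z) (snd z)"
proof -
  obtain u v where u: "represents T u \<eta> \<sigma>" and v: "represents T v \<eta>' \<sigma>'"
    using solves_L_imp_flow[OF assms(1)] solves_L_imp_flow[OF assms(2)] by metis
  then have flows: "flow_on T u" "flow_on T v" by (simp_all add: represents_def)
  have flow_meas: "(\<lambda>z. f (fst z) (snd z)) \<in> borel_measurable borel" if "flow_on T f"
    for f :: "real \<Rightarrow> real^'d \<Rightarrow> real"
    using that
    unfolding flow_on_def measurable_cong_sets[OF sets_borel_pair_torus_measure refl] case_prod_beta'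
    by blast
  have "{z \<in> space borel. u (fst z) (snd z) = v (fst z) (snd z)} \<in> sets borel"
    using flow_meas[OF flows(1)] flow_meas[OF flows(2)] by (rule borel_measurable_eq)
  then have u_eq_v: "AE z in lborel. z \<in> {0..T} \<times> torus \<longrightarrow> u (fst z) (snd z) = v (fst z) (snd z)"
    by (intro AE_Times_torus_if_all_AE flow_unique[OF flows]) auto
  have mean_eq: "lagrangian_mean p (u t) = lagrangian_mean p (v t)" if t: "t \<in> {0..T}" for t
    unfolding lagrangian_mean_def
  proof (rule integral_cong_AE)
    note [measurable] = flow_measurable[OF flows(1)] flow_measurable[OF flows(2)]
      borel_measurable_comp_lagrangian_density[OF p_cont]
    show "(\<lambda>y. p (lagrangian_density (u t) y) * exp (u t y)) \<in> borel_measurable torus_measure"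
      "(\<lambda>y. p (lagrangian_density (v t) y) * exp (v t y)) \<in> borel_measurable torus_measure"
      by measurable
    show "AE y in torus_measure. p (lagrangian_density (u t) y) * exp (u t y)
        = p (lagrangian_density (v t) y) * exp (v t y)"
      using flow_unique[OF flows t] by eventually_elim (simp add: lagrangian_density_def)
  qed
  show ?thesis
    unfolding AE_completion_iff
    using u_eq_v u[unfolded represents_def, THEN conjunct2] v[unfolded represents_def, THEN conjunct2]
    by eventually_elim (auto simp: relative_pressure_def lagrangian_density_def mean_eq)
qed

end

section \<open>The pressure potential\<close>

lemma interval_integral_has_real_derivative:
  fixes f :: "real \<Rightarrow> real"
  assumes f: "continuous_on {0<..} f" and "0 < c" "0 < x"
  shows "((\<lambda>x. interval_lebesgue_integral lborel (ereal c) (ereal x) f) has_real_derivative f x) (at x)"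
proof -
  define a b where "a = min x c / 2" and "b = max x c + 1"
  have ab: "0 < a" "a < x" "a \<le> c" "x < b" "c \<le> b" using assms by (auto simp: a_def b_def)
  have "((\<lambda>x. interval_lebesgue_integral lborel (ereal c) (ereal x) f) has_vector_derivative f x)
      (at x within {a..b})"
    using ab by (intro interval_integral_FTC2 continuous_on_subset[OF f]) auto
  moreover have "at x within {a..b} = at x" using ab by (intro at_within_interior) auto
  ultimately show ?thesis by (simp add: has_real_derivative_iff_has_vector_derivative)
qed

lemma continuous_on_div_square: "continuous_on {0..} p \<Longrightarrow> continuous_on {0<..} (\<lambda>s. p s / s\<^sup>2 :: real)"
  by (auto intro!: continuous_intros intro: continuous_on_subset)

lemma Pfun_derivative:
  assumes p: "continuous_on {0..} p" and rhobar: "0 < rhobar" and x: "0 < x"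
  shows "(Pfun p rhobar C1 C2 has_real_derivative (p x + Pfun p rhobar C1 C2 x - C2) / x) (at x)"
proof -
  let ?I = "\<lambda>x. interval_lebesgue_integral lborel (ereal rhobar) (ereal x) (\<lambda>s. p s / s\<^sup>2)"
  have "(?I has_real_derivative p x / x\<^sup>2) (at x)"
    by (rule interval_integral_has_real_derivative[OF continuous_on_div_square[OF p] rhobar x])
  then have "((\<lambda>x. x * ?I x + C1 * x + C2) has_real_derivative (?I x + x * (p x / x\<^sup>2) + C1)) (at x)"
    by (auto intro!: derivative_eq_intros)
  moreover have "?I x + x * (p x / x\<^sup>2) + C1 = (p x + Pfun p rhobar C1 C2 x - C2) / x"
    unfolding Pfun_def using x by (simp add: field_simps power2_eq_square)
  ultimately show ?thesis
    unfolding Pfun_def[abs_def] by simp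
qed

lemma continuous_on_atLeast_0_tendsto:
  fixes p :: "real \<Rightarrow> real"
  shows "continuous_on {0..} p \<Longrightarrow> (p \<longlongrightarrow> p 0) (at_right 0)"
  by (simp add: continuous_on_def at_within_Ici_at_right[symmetric])

lemma Pfun_tendsto_at_right_0:
  assumes p: "continuous_on {0..} p" and rhobar: "0 < rhobar"
  shows "(Pfun p rhobar C1 C2 \<longlongrightarrow> C2 - p 0) (at_right 0)"
proof -
  let ?I = "\<lambda>x. interval_lebesgue_integral lborel (ereal rhobar) (ereal x) (\<lambda>s. p s / s\<^sup>2)"
  have pos: "eventually (\<lambda>x::real. 0 < x) (at_right 0)" by (rule eventually_at_right_less)
  have "((\<lambda>x. ?I x / inverse x) \<longlongrightarrow> - p 0) (at_right 0)"
  proof (rule lhopital_right_0_at_top[where f'="\<lambda>x. p x / x\<^sup>2" and g'="\<lambda>x. - inverse (x\<^sup>2)"])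
    show "LIM x at_right 0. inverse x :> (at_top :: real filter)"
      by (rule filterlim_inverse_at_top_right)
    show "eventually (\<lambda>x. - inverse (x\<^sup>2) \<noteq> (0::real)) (at_right 0)" using pos by eventually_elim auto
    show "eventually (\<lambda>x. (?I has_real_derivative p x / x\<^sup>2) (at x)) (at_right 0)"
      using pos
      by eventually_elim
        (rule interval_integral_has_real_derivative[OF continuous_on_div_square[OF p] rhobar])
    show "eventually (\<lambda>x::real. (inverse has_real_derivative - inverse (x\<^sup>2)) (at x)) (at_right 0)"
      using pos by eventually_elim (auto intro!: derivative_eq_intros simp: power2_eq_square)
    have "((\<lambda>x. - p x) \<longlongrightarrow> - p 0) (at_right 0)"
      by (intro tendsto_intros continuous_on_atLeast_0_tendsto p)
    then show "((\<lambda>x. p x / x\<^sup>2 / - inverse (x\<^sup>2)) \<longlongrightarrow> - p 0) (at_right 0)"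
      by (rule Lim_transform_eventually) (use pos in eventually_elim, simp add: field_simps)
  qed
  then have "((\<lambda>x. ?I x / inverse x + C1 * x + C2) \<longlongrightarrow> - p 0 + C1 * 0 + C2) (at_right 0)"
    by (intro tendsto_intros)
  moreover have "?I x / inverse x + C1 * x + C2 = Pfun p rhobar C1 C2 x" for x
    by (simp add: Pfun_def divide_inverse)
  ultimately show ?thesis by simp
qed

lemma C1_lipschitz_on_Icc:
  fixes p D :: "real \<Rightarrow> real"
  assumes deriv: "\<And>x. 0 \<le> x \<Longrightarrow> (p has_real_derivative D x) (at x within {0..})"
    and D: "continuous_on {0..} D"
  shows "\<exists>L. L-lipschitz_on {0..b} p"
proof -
  obtain L where L: "0 < L" "\<And>x. x \<in> {0..b} \<Longrightarrow> \<bar>D x\<bar> \<le> L"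
    using continuous_on_atLeast_bounded_on_Icc[OF D] by metis
  have "L-lipschitz_on {0..b} p"
  proof (rule lipschitz_onI)
    fix x y assume "x \<in> {0..b}" "y \<in> {0..b}"
    then show "dist (p x) (p y) \<le> L * dist x y"
      unfolding dist_norm
      using L(2) by (intro field_differentiable_bound[of "{0..b}" p D])
         (auto intro: has_field_derivative_subset[OF deriv])
  qed (use L in simp)
  then show ?thesis by blast
qed

text \<open>At 0 the value of \<open>Pfun\<close> is \<open>C2\<close>, which differs from its limit \<open>C2 - p 0\<close>.\<close>

definition potential :: "(real \<Rightarrow> real) \<Rightarrow> real \<Rightarrow> real \<Rightarrow> real \<Rightarrow> real \<Rightarrow> real" where
  "potential p rhobar C1 C2 x = (if x = 0 then C2 - p 0 else Pfun p rhobar C1 C2 x)"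

lemma potential_derivative:
  assumes "continuous_on {0..} p" "0 < rhobar" "0 < x"
  shows "(potential p rhobar C1 C2 has_real_derivative
    (p x + potential p rhobar C1 C2 x - C2) / x) (at x)"
proof -
  have "(potential p rhobar C1 C2 has_real_derivative (p x + Pfun p rhobar C1 C2 x - C2) / x) (at x)"
    by (rule has_field_derivative_transform_within[OF Pfun_derivative[OF assms] assms(3)])
       (auto simp: potential_def dist_real_def)
  then show ?thesis using assms(3) by (simp add: potential_def)
qed

lemma continuous_on_potential:
  assumes "continuous_on {0..} p" "0 < rhobar"
  shows "continuous_on {0..} (potential p rhobar C1 C2)"
  unfolding continuous_on_eq_continuous_within
proof
  fix x :: real assume x: "x \<in> {0..}"
  show "continuous (at x within {0..}) (potential p rhobar C1 C2)"
  proof (cases "x = 0")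
    case True
    have "(potential p rhobar C1 C2 \<longlongrightarrow> C2 - p 0) (at_right 0)"
      by (rule Lim_transform_eventually[OF Pfun_tendsto_at_right_0[OF assms, of C1]])
         (auto simp: potential_def eventually_at_filter)
    then show ?thesis using True by (simp add: continuous_within at_within_Ici_at_right potential_def)
  next
    case False
    then show ?thesis
      using x DERIV_isCont[OF potential_derivative[OF assms]]
      by (auto intro: continuous_at_imp_continuous_within)
  qed
qed

lemma Hp_imp_coercive_pressure:
  assumes "Hp p"
  obtains C C2 P where "coercive_pressure p C C2 P"
proof -
  obtain D where D: "\<And>x. x \<ge> 0 \<Longrightarrow> (p has_real_derivative D x) (at x within {0..})"
    "continuous_on {0..} D"
    using assms unfolding Hp_def by blast
  obtain C C1 C2 rhobar where C: "0 < C" and rhobar: "0 < rhobar" and lower: "\<forall>x\<ge>0. - C \<le> p x"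
    and upper: "\<forall>x>0. p x \<le> C * Pfun p rhobar C1 C2 x \<and> 0 \<le> Pfun p rhobar C1 C2 x"
    using assms unfolding Hp_def by (elim conjE exE) (rule that)
  interpret pressure_law p
    by standard (rule C1_lipschitz_on_Icc[OF D])
  let ?P = "potential p rhobar C1 C2"
  have pos: "p x \<le> C * ?P x" if "0 < x" for x
    using upper that by (simp add: potential_def)
  have "p 0 \<le> C * ?P 0"
  proof (rule tendsto_le[of "at_right 0"])
    show "((\<lambda>x. C * ?P x) \<longlongrightarrow> C * ?P 0) (at_right 0)"
      by (intro tendsto_intros continuous_on_atLeast_0_tendsto continuous_on_potential p_cont rhobar)
    show "(p \<longlongrightarrow> p 0) (at_right 0)"
      by (rule continuous_on_atLeast_0_tendsto[OF p_cont])
    show "eventually (\<lambda>x. p x \<le> C * ?P x) (at_right 0)"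
      using pos by (auto simp: eventually_at_filter)
  qed simp
  then have p_le: "p x \<le> C * ?P x" if "0 \<le> x" for x
    using pos[of x] that by (cases "x = 0") auto
  have "coercive_pressure p C C2 ?P"
  proof
    show "continuous_on {0..} ?P" by (rule continuous_on_potential[OF p_cont rhobar])
    show "(?P has_real_derivative (p x + ?P x - C2) / x) (at x)" if "0 < x" for x
      by (rule potential_derivative[OF p_cont rhobar that])
    show "\<exists>x\<ge>0. K < p x" for K using assms unfolding Hp_def by blast
  qed (use C lower p_le in \<open>auto simp: potential_def\<close>)
  then show thesis by (rule that)
qed

section \<open>The main theorem\<close>

lemma Linfty_on_nonneg_representative:
  assumes "Linfty_on S f" "AE x in lebesgue. x \<in> S \<longrightarrow> 0 \<le> f x"
  obtains g B where "g \<in> borel_measurable borel" "\<And>x. g x \<in> {0..B}" "AE x in lborel. x \<in> S \<longrightarrow> f x = g x"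
proof -
  obtain g B where g: "g \<in> borel_measurable borel" "\<And>x. \<bar>g x\<bar> \<le> B" "AE x in lborel. x \<in> S \<longrightarrow> f x = g x"
    using Linfty_on_borel_representative[OF assms(1)] by blast
  show thesis
  proof (rule that[of "\<lambda>x. max 0 (g x)" B])
    show "(\<lambda>x. max 0 (g x)) \<in> borel_measurable borel" using g(1) by measurable
    show "max 0 (g x) \<in> {0..B}" for x using g(2)[of x] by auto
    show "AE x in lborel. x \<in> S \<longrightarrow> f x = max 0 (g x)"
      using g(3) assms(2)[unfolded AE_completion_iff] by eventually_elim auto
  qed
qed

locale coercive_torus_lagrangian_system =
  torus_lagrangian_system p \<rho> R rho0 + coercive_pressure p C C2 P
  for p and \<rho> :: "real^'d \<Rightarrow> real" and R rho0 C C2 P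
begin

sublocale coercive_lagrangian_system torus_measure p \<rho> R C C2 P ..

lemma solves_L_le_barrier:
  assumes sol: "solves_L p rho0 T \<eta> \<sigma>" and r: "is_barrier r"
  shows "AE z in lebesgue. z \<in> {0..T} \<times> torus \<longrightarrow> \<bar>\<eta> (fst z) (snd z)\<bar> \<le> r"
proof -
  obtain u where u: "represents T u \<eta> \<sigma>" using solves_L_imp_flow[OF sol] .
  then have "AE z in lborel. z \<in> {0..T} \<times> torus \<longrightarrow> lagrangian_density (u (fst z)) (snd z) \<le> r"
    by (intro AE_Times_torusI flow_density_le_barrier[OF _ r]) (simp add: represents_def)
  with u[unfolded represents_def, THEN conjunct2] show ?thesis
    unfolding AE_completion_iff by eventually_elim (auto simp: lagrangian_density_nonneg)
qed

end

lemma Hp_imp_coercive_torus_lagrangian_system: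
  fixes rho0 :: "real^'d \<Rightarrow> real"
  assumes "Hp p" "Linfty_on torus rho0" "AE y in lebesgue. y \<in> torus \<longrightarrow> 0 \<le> rho0 y"
  obtains \<rho> R C C2 P where "coercive_torus_lagrangian_system p \<rho> R rho0 C C2 P"
proof -
  obtain C C2 P where "coercive_pressure p C C2 P" using Hp_imp_coercive_pressure[OF assms(1)] .
  then interpret coercive_pressure p C C2 P .
  obtain \<rho> R where \<rho>: "\<rho> \<in> borel_measurable borel" "\<And>y. \<rho> y \<in> {0..R}"
    "AE y in lborel. y \<in> torus \<longrightarrow> rho0 y = \<rho> y"
    using Linfty_on_nonneg_representative[OF assms(2,3)] by blast
  interpret prob_space "torus_measure :: (real^'d) measure" by (rule prob_space_torus_measure)
  have "coercive_torus_lagrangian_system p \<rho> R rho0 C C2 P"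
    by standard (use \<rho> in \<open>auto simp: AE_torus_measure_iff\<close>)
  then show thesis by (rule that)
qed

theorem theorem2:
  fixes p :: "real \<Rightarrow> real" and rho0 :: "real^'d \<Rightarrow> real"
  assumes "Hp p"
    and "Linfty_on torus rho0"
    and "AE y in lebesgue. y \<in> torus \<longrightarrow> 0 \<le> rho0 y"
  shows "\<exists>r. \<forall>T>0.
     (\<exists>\<eta> \<sigma>. solves_L p rho0 T \<eta> \<sigma>) \<and>
     (\<forall>\<eta> \<sigma> \<eta>' \<sigma>'. solves_L p rho0 T \<eta> \<sigma> \<and> solves_L p rho0 T \<eta>' \<sigma>' \<longrightarrow>
        (AE z in lebesgue. z \<in> {0..T} \<times> torus \<longrightarrow>
           \<eta> (fst z) (snd z) = \<eta>' (fst z) (snd z) \<and> \<sigma> (fst z) (snd z) = \<sigma>' (fst z) (snd z))) \<and>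
     (\<forall>\<eta> \<sigma>. solves_L p rho0 T \<eta> \<sigma> \<longrightarrow>
        (AE z in lebesgue. z \<in> {0..T} \<times> torus \<longrightarrow> \<bar>\<eta> (fst z) (snd z)\<bar> \<le> r))"
proof -
  obtain \<rho> R C C2 P where "coercive_torus_lagrangian_system p \<rho> R rho0 C C2 P"
    using Hp_imp_coercive_torus_lagrangian_system[OF assms] .
  then interpret coercive_torus_lagrangian_system p \<rho> R rho0 C C2 P .
  obtain r where r: "is_barrier r" using barrier_exists by blast
  show ?thesis
  proof (intro exI[of _ r] allI impI conjI)
    fix T :: real assume "0 < T"
    then obtain u where "flow_on T u" using flow_exists[of T] by auto
    then show "\<exists>\<eta> \<sigma>. solves_L p rho0 T \<eta> \<sigma>" using solves_L_if_flow by blast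
  qed (use solves_L_unique solves_L_le_barrier[OF _ r] in blast)+
qed

end
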